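(* Let $A_i\in\mathbb{C}_{\rm H}^{m_i}$ and $B_i\in\mathbb{C}^{m_i\times n}$ be given for $i=1,2$, let $\phi(X)=A_1-B_1XB_1^{*}$, and assume that $B_2XB_2^{*}\succcurlyeq A_2$ has a solution $X\in\mathbb{C}_{\rm H}^{n}$. Then there exists $X_0\in\mathbb{C}_{\rm H}^{n}$ such that $$B_2X_0B_2^{*}\succcurlyeq A_2\quad\text{and}\quad \phi(X_0)\succcurlyeq\phi(X)\ \text{ for all } X\in\mathbb{C}_{\rm H}^{n} \text{ with } B_2XB_2^{*}\succcurlyeq A_2$$ if and only if $${\mathscr R}\begin{bmatrix} 0\\ B_1^{*}\end{bmatrix}\subseteq{\mathscr R}\begin{bmatrix} -A_2 & B_2\\ B_2^{*} & 0\end{bmatrix}.$$ In this case, a global maximizer $X_0\in\mathbb{C}_{\rm H}^{n}$ is given by $$X_0=[\,0,\,I_n\,]\begin{bmatrix} -A_2 & B_2\\ B_2^{*} & 0\end{bmatrix}^{\dagger}\begin{bmatrix} 0\\ I_n\end{bmatrix},$$ and the global maximal matrix can be written as $$\max_{\succcurlyeq}\{\,A_1-B_1XB_1^{*}\mid B_2XB_2^{*}\succcurlyeq A_2,\ X\in\mathbb{C}_{\rm H}^{n}\,\}=A_1-[\,0,\,B_1\,]\begin{bmatrix} -A_2 & B_2\\ B_2^{*} & 0\end{bmatrix}^{\dagger}\begin{bmatrix} 0\\ B_1^{*}\end{bmatrix},$$ which satisfies $$i_{\pm}\!\left(A_1-[\,0,\,B_1\,]\begin{bmatrix} -A_2 &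 B_2\\ B_2^{*} & 0\end{bmatrix}^{\dagger}\begin{bmatrix} 0\\ B_1^{*}\end{bmatrix}\right)=i_{\pm}(M)-i_{\pm}\begin{bmatrix} -A_2 & B_2\\ B_2^{*} & 0\end{bmatrix},\qquad M=\begin{bmatrix} A_1 & 0 & B_1\\ 0 & -A_2 & B_2\\ B_1^{*} & B_2^{*} & 0\end{bmatrix}.$$
   Context: $\mathbb{C}_{\rm H}^{m}$ is the set of $m\times m$ complex Hermitian matrices. ${\mathscr R}(\cdot)$ is range (column space), $A^{*}$ is the conjugate transpose, $A^{\dagger}$ is the Moore--Penrose inverse. $i_{+}(A)$ and $i_{-}(A)$ are the numbers of positive and negative eigenvalues of a Hermitian matrix $A$, counted with multiplicity; a formula with $i_{\pm}$ stands for the two formulas with upper and with lower signs. For Hermitian $P,Q$, $P\succcurlyeq Q$ means $P-Q$ is positive semi-definite (L\"owner partial ordering). $\max_{\succcurlyeq}S$ denotes the greatest element of a set $S$ of Hermitian matrices in this ordering. *)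

theory Defs
  imports
    "Jordan_Normal_Form.Schur_Decomposition"
    "Jordan_Normal_Form.VS_Connect"
begin

definition hermitian_mats :: "nat \<Rightarrow> complex mat set" where
  "hermitian_mats n = {A \<in> carrier_mat n n. mat_adjoint A = A}"

(* (A *\<^sub>v v) \<bullet>c v is v^* A v; the order on complex numbers is the one with
   0 \<le> z iff z is real and nonnegative. *)
definition positive_semidefinite :: "complex mat \<Rightarrow> bool" where
  "positive_semidefinite A \<longleftrightarrow>
     A \<in> hermitian_mats (dim_row A) \<and>
     (\<forall>v \<in> carrier_vec (dim_row A). 0 \<le> (A *\<^sub>v v) \<bullet>c v)"

definition loewner_ge :: "complex mat \<Rightarrow> complex mat \<Rightarrow> bool" (infix \<open>\<succeq>\<close> 50) where
  "P \<succeq> Q \<longleftrightarrow>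
     P \<in> hermitian_mats (dim_row P) \<and> Q \<in> hermitian_mats (dim_row P) \<and>
     positive_semidefinite (P - Q)"

(* The relation \<succeq> is antisymmetric, so a set has at most one greatest element:
   "is_loewner_max S G" says that the maximum of S exists and equals G. *)
definition is_loewner_max :: "complex mat set \<Rightarrow> complex mat \<Rightarrow> bool" where
  "is_loewner_max S G \<longleftrightarrow> G \<in> S \<and> (\<forall>P \<in> S. G \<succeq> P)"

definition is_mp_inverse :: "complex mat \<Rightarrow> complex mat \<Rightarrow> bool" where
  "is_mp_inverse A G \<longleftrightarrow>
     G \<in> carrier_mat (dim_col A) (dim_row A) \<and>
     A * G * A = A \<and> G * A * G = G \<and>
     mat_adjoint (A * G) = A * G \<and> mat_adjoint (G * A) = G * A"

definition mp_inverse :: "complex mat \<Rightarrow> complex mat" where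
  "mp_inverse A = (THE G. is_mp_inverse A G)"

abbreviation mat_range :: "complex mat \<Rightarrow> complex vec set" where
  "mat_range A \<equiv> vec_space.col_space (dim_row A) A"

(* Multiplicities are algebraic, i.e. orders as roots of the characteristic polynomial;
   for Hermitian matrices these are also the geometric ones. *)
definition inertia_pos :: "complex mat \<Rightarrow> nat" where
  "inertia_pos A =
     (\<Sum>x \<in> {x :: real. 0 < x \<and> eigenvalue A (of_real x)}. order (of_real x) (char_poly A))"

definition inertia_neg :: "complex mat \<Rightarrow> nat" where
  "inertia_neg A =
     (\<Sum>x \<in> {x :: real. x < 0 \<and> eigenvalue A (of_real x)}. order (of_real x) (char_poly A))"

(* Side-by-side block matrix [A, B], the counterpart of the stacked matrix A @\<^sub>r B. *)
definition append_cols :: "complex mat \<Rightarrow> complex mat \<Rightarrow> complex mat" (infixr \<open>@\<^sub>c\<close> 65) where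
  "A @\<^sub>c B = four_block_mat A B (0\<^sub>m 0 (dim_col A)) (0\<^sub>m 0 (dim_col B))"

end

theory Submission
  imports Defs
begin

text \<open>
  Everything follows from one linear system. Let \<open>C\<close> be \<open>B1\<close> or \<open>B2\<close>, and suppose that for some
  vector \<open>w\<close> the vector \<open>(0, C\<^sup>* w)\<close> lies in the range of the bordered matrix \<open>K\<close>. A solution
  \<open>(u, x)\<close> of \<open>K (u, x) = (0, C\<^sup>* w)\<close> satisfies \<open>B2 x = A2 u\<close> and \<open>B2\<^sup>* u = C\<^sup>* w\<close>, and choosing
  it by the Moore-Penrose inverse gives \<open>x = Xhat C\<^sup>* w\<close>. Hence
  \<open>w\<^sup>* (C Xhat C\<^sup>*) w = w\<^sup>* C x = u\<^sup>* B2 x = u\<^sup>* A2 u\<close> (\<open>bordered_solution\<close>).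

  Optimality of \<open>Xhat\<close> is the case \<open>C = B1\<close>: for feasible \<open>X\<close>,
  \<open>w\<^sup>* B1 X B1\<^sup>* w = u\<^sup>* B2 X B2\<^sup>* u \<ge> u\<^sup>* A2 u\<close>, a bound that \<open>Xhat\<close> attains for every \<open>w\<close>
  simultaneously (\<open>bordered_lower_bound\<close>). Feasibility of \<open>Xhat\<close> is the case \<open>C = B2\<close>: then
  \<open>p = w - u\<close> lies in the kernel of \<open>B2\<^sup>*\<close>; there \<open>A2\<close> is negative semidefinite as soon as some
  feasible point exists, and \<open>A2 u = B2 x\<close> is orthogonal to \<open>p\<close>, so
  \<open>w\<^sup>* A2 w = u\<^sup>* A2 u + p\<^sup>* A2 p \<le> u\<^sup>* A2 u\<close> (\<open>bordered_solution_feasible\<close>).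

  The range condition amounts to \<open>ker B2 \<subseteq> ker B1\<close> (\<open>bordered_range_iff\<close>): the range of the
  Hermitian matrix \<open>K\<close> is the orthogonal complement of its kernel, and \<open>K (u, x) = 0\<close> forces
  \<open>B2 x = 0\<close>, because \<open>u\<^sup>* A2 u = u\<^sup>* B2 x = 0\<close> and \<open>B2\<^sup>* u = 0\<close> put \<open>u\<close> into the kernel of the
  semidefinite matrix \<open>B2 X B2\<^sup>* - A2\<close>. For \<open>C = B2\<close> the condition is therefore automatic. For
  \<open>C = B1\<close> it is necessary: if \<open>X0\<close> is a maximizer and \<open>B2 x = 0\<close>, then \<open>X0 - x x\<^sup>*\<close> is again feasible,
  and it would improve on \<open>X0\<close> in the direction \<open>B1 x\<close> unless \<open>B1 x = 0\<close> (\<open>least_imp_kernel_le\<close>).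

  Finally the maximal value is the generalized Schur complement of \<open>K\<close> in \<open>M\<close>. Block elimination is a
  congruence between \<open>M\<close> and the block diagonal matrix of the Schur complement and \<open>K\<close>, so the
  inertia formula is Sylvester's law (\<open>sylvester_law_of_inertia\<close>, \<open>inertia_schur_complement\<close>). The
  spectral theorem provides both the Moore-Penrose inverse and the inertia of Hermitian matrices.
\<close>

section \<open>Adjoints and Hermitian matrices\<close>

lemma mat_adjoint_dim [simp]:
  "dim_row (mat_adjoint A) = dim_col A" "dim_col (mat_adjoint A) = dim_row A"
  by (auto simp: mat_adjoint_def)

lemma mat_adjoint_index [simp]:
  "i < dim_col A \<Longrightarrow> j < dim_row A \<Longrightarrow> mat_adjoint A $$ (i, j) = conjugate (A $$ (j, i))"
  by (auto simp: mat_adjoint_def mat_of_rows_index)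

lemma mat_adjoint_carrier [simp]:
  "mat_adjoint A \<in> carrier_mat n m \<longleftrightarrow> A \<in> carrier_mat m n"
  by (metis carrier_matD carrier_matI mat_adjoint_dim)

lemma mat_adjoint_adjoint [simp]: "mat_adjoint (mat_adjoint A) = A"
  by (rule eq_matI) auto

lemma mat_adjoint_mult:
  fixes A B :: "complex mat"
  assumes "A \<in> carrier_mat m k" "B \<in> carrier_mat k n"
  shows "mat_adjoint (A * B) = mat_adjoint B * mat_adjoint A"
  by (rule eq_matI) (use assms in \<open>auto simp: scalar_prod_def mult.commute intro!: sum.cong\<close>)

lemma mat_adjoint_minus:
  fixes A B :: "complex mat"
  assumes "A \<in> carrier_mat m n" "B \<in> carrier_mat m n"
  shows "mat_adjoint (A - B) = mat_adjoint A - mat_adjoint B"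
  by (rule eq_matI) (use assms in auto)

lemma mat_adjoint_one [simp]: "mat_adjoint (1\<^sub>m n :: complex mat) = 1\<^sub>m n"
  by (rule eq_matI) auto

lemma mat_adjoint_zero [simp]: "mat_adjoint (0\<^sub>m m n :: complex mat) = 0\<^sub>m n m"
  by (rule eq_matI) auto

lemma mat_adjoint_four_block:
  fixes A B C D :: "complex mat"
  assumes "A \<in> carrier_mat m1 n1" "B \<in> carrier_mat m1 n2"
    "C \<in> carrier_mat m2 n1" "D \<in> carrier_mat m2 n2"
  shows "mat_adjoint (four_block_mat A B C D) =
    four_block_mat (mat_adjoint A) (mat_adjoint C) (mat_adjoint B) (mat_adjoint D)"
  by (rule eq_matI) (use assms in auto)

lemma mat_adjoint_diag:
  "mat_adjoint (mat_diag n (\<lambda>i. complex_of_real (d i))) = mat_diag n (\<lambda>i. complex_of_real (d i))"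
  by (rule eq_matI) (auto simp: mat_diag_def)

lemma mult_mat_vec_cscalar_adjoint:
  fixes A :: "complex mat"
  assumes "A \<in> carrier_mat m n" "v \<in> carrier_vec n" "w \<in> carrier_vec m"
  shows "(A *\<^sub>v v) \<bullet>c w = v \<bullet>c (mat_adjoint A *\<^sub>v w)"
proof -
  have "(A *\<^sub>v v) \<bullet>c w = (\<Sum>i<m. \<Sum>j<n. A $$ (i,j) * v $ j * cnj (w $ i))"
    using assms by (auto simp: scalar_prod_def sum_distrib_right atLeast0LessThan)
  also have "\<dots> = (\<Sum>j<n. \<Sum>i<m. A $$ (i,j) * v $ j * cnj (w $ i))"
    by (rule sum.swap)
  also have "\<dots> = v \<bullet>c (mat_adjoint A *\<^sub>v w)"
    using assms by (auto simp: scalar_prod_def sum_distrib_left atLeast0LessThan mult_ac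
        intro!: sum.cong)
  finally show ?thesis .
qed

lemma hermitian_matsD:
  assumes "A \<in> hermitian_mats n"
  shows "A \<in> carrier_mat n n" "mat_adjoint A = A"
  using assms by (auto simp: hermitian_mats_def)

lemma hermitian_mats_index:
  assumes "A \<in> hermitian_mats n" "i < n" "j < n"
  shows "A $$ (i, j) = cnj (A $$ (j, i))"
proof -
  note A = hermitian_matsD[OF assms(1)]
  have "A $$ (i, j) = mat_adjoint A $$ (i, j)" by (simp only: A(2))
  also have "\<dots> = cnj (A $$ (j, i))" using A(1) assms(2,3) by (subst mat_adjoint_index) auto
  finally show ?thesis .
qed

lemma hermitian_mats_congruence:
  assumes "A \<in> hermitian_mats n" "T \<in> carrier_mat m n"
  shows "T * A * mat_adjoint T \<in> hermitian_mats m"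
proof -
  note A = hermitian_matsD[OF assms(1)]
  have "mat_adjoint (T * A * mat_adjoint T) = mat_adjoint (mat_adjoint T) * mat_adjoint (T * A)"
    by (rule mat_adjoint_mult[of _ m n _ m]) (use A assms(2) in auto)
  also have "\<dots> = T * (A * mat_adjoint T)"
    using A assms(2) by (simp add: mat_adjoint_mult[of _ m n _ n])
  also have "\<dots> = T * A * mat_adjoint T"
    using A assms(2) by (intro assoc_mult_mat[symmetric]) auto
  finally show ?thesis
    using A assms(2) by (auto simp: hermitian_mats_def)
qed

lemma hermitian_mats_minus:
  assumes "A \<in> hermitian_mats n" "B \<in> hermitian_mats n"
  shows "A - B \<in> hermitian_mats n"
  unfolding hermitian_mats_def
  using hermitian_matsD[OF assms(1)] hermitian_matsD[OF assms(2)]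
  by (simp add: mat_adjoint_minus minus_carrier_mat)

lemma hermitian_mats_uminus:
  assumes "A \<in> hermitian_mats n"
  shows "- A \<in> hermitian_mats n"
proof -
  have "mat_adjoint (- A) = - A"
    by (rule eq_matI)
      (use hermitian_matsD(1)[OF assms] in \<open>auto simp: hermitian_mats_index[OF assms, symmetric]\<close>)
  thus ?thesis using hermitian_matsD(1)[OF assms] by (simp add: hermitian_mats_def)
qed

lemma mat_diag_of_real_hermitian: "mat_diag n (\<lambda>i. complex_of_real (d i)) \<in> hermitian_mats n"
  by (simp add: hermitian_mats_def mat_adjoint_diag)

lemma zero_mat_mult_vec:
  "w \<in> carrier_vec k \<Longrightarrow> 0\<^sub>m m k *\<^sub>v w = (0\<^sub>v m :: complex vec)"
  by (rule eq_vecI) auto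

lemma mult_mat_zero_vec:
  "X \<in> carrier_mat m n \<Longrightarrow> X *\<^sub>v 0\<^sub>v n = (0\<^sub>v m :: complex vec)"
  by (rule eq_vecI) auto

lemma mat_diag_mult_vec:
  fixes y :: "complex vec"
  assumes y: "y \<in> carrier_vec n"
  shows "mat_diag n f *\<^sub>v y = vec n (\<lambda>i. f i * y $ i)"
proof (rule eq_vecI)
  fix i assume "i < dim_vec (vec n (\<lambda>i. f i * y $ i))"
  hence i: "i < n" by simp
  have "(mat_diag n f *\<^sub>v y) $ i = (\<Sum>j<n. (if i = j then f j else 0) * y $ j)"
    using i y by (simp add: mat_diag_def scalar_prod_def atLeast0LessThan)
  also have "\<dots> = (\<Sum>j<n. if i = j then f j * y $ j else 0)"
    by (rule sum.cong) auto
  finally show "(mat_diag n f *\<^sub>v y) $ i = vec n (\<lambda>i. f i * y $ i) $ i"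
    using i by simp
qed (simp add: mat_diag_def)

lemma minus_vec_eq_zero_iff:
  assumes "a \<in> carrier_vec n" "b \<in> carrier_vec n"
  shows "a - b = 0\<^sub>v n \<longleftrightarrow> a = (b :: complex vec)"
  using assms by (auto simp: vec_eq_iff)

text \<open>By this substitution all Loewner inequalities below become inequalities of scalars, one for each
  vector.\<close>

lemma quadratic_form_congruence:
  fixes X B :: "complex mat"
  assumes "X \<in> carrier_mat n n" "B \<in> carrier_mat m n" "v \<in> carrier_vec m"
  shows "((B * X * mat_adjoint B) *\<^sub>v v) \<bullet>c v = (X *\<^sub>v (mat_adjoint B *\<^sub>v v)) \<bullet>c (mat_adjoint B *\<^sub>v v)"
proof -
  have c: "mat_adjoint B *\<^sub>v v \<in> carrier_vec n"
    using assms by (auto intro: mult_mat_vec_carrier[of _ n m])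
  have "(B * X * mat_adjoint B) *\<^sub>v v = B *\<^sub>v (X *\<^sub>v (mat_adjoint B *\<^sub>v v))"
    using assms c by (simp add: assoc_mult_mat_vec[of _ m n _ m] assoc_mult_mat_vec[of _ m n _ n])
  thus ?thesis
    using mult_mat_vec_cscalar_adjoint[OF assms(2) _ assms(3)] assms(1) c by simp
qed

section \<open>The spectral theorem\<close>

text \<open>The deflation step of the spectral theorem: complete an eigenvector to a unitary matrix.\<close>

lemma unitary_with_first_column:
  fixes v :: "complex vec"
  assumes v: "v \<in> carrier_vec n" and v0: "v \<noteq> 0\<^sub>v n"
  obtains W c where "W \<in> carrier_mat n n" "mat_adjoint W * W = 1\<^sub>m n" "col W 0 = c \<cdot>\<^sub>v v"
proof -
  interpret cof_vec_space n "TYPE(complex)" .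
  define b where "b = basis_completion v"
  define ws where "ws = gram_schmidt n b"
  note bc = basis_completion[OF v v0, folded b_def]
  have n: "0 < n" using v v0 by (cases n) auto
  obtain vs where bv: "b = v # vs" using bc(6,7) n by (cases b) auto
  have ws: "corthogonal ws" "set ws \<subseteq> carrier_vec n" "length ws = n"
    using gram_schmidt_result[OF bc(2,4,5) refl, folded ws_def] bc(6) by auto
  have hd: "hd ws = v" using gram_schmidt_hd[OF v, of vs] by (simp add: ws_def bv)
  hence ws0: "ws ! 0 = v" using ws(3) n by (cases ws) auto
  define r where "r j = Re (ws ! j \<bullet>c ws ! j)" for j
  have wsc: "ws ! j \<in> carrier_vec n" if "j < n" for j using ws that by auto
  have r: "ws ! j \<bullet>c ws ! j = of_real (r j)" "0 < r j" if "j < n" for j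
  proof -
    have "0 \<le> ws ! j \<bullet>c ws ! j" "ws ! j \<bullet>c ws ! j \<noteq> 0"
      using corthogonalD[OF ws(1), of j j] that ws(3) by auto
    thus "ws ! j \<bullet>c ws ! j = of_real (r j)" "0 < r j"
      by (auto simp: r_def less_eq_complex_def complex_eq_iff)
  qed
  \<comment> \<open>Gram-Schmidt yields orthogonal columns; dividing by their norms makes them orthonormal.\<close>
  define W where "W = mat n n (\<lambda>(i,j). ws ! j $ i / of_real (sqrt (r j)))"
  have W: "W \<in> carrier_mat n n" by (simp add: W_def)
  have "(mat_adjoint W * W) $$ (i,j) = (1\<^sub>m n) $$ (i,j)" if ij: "i < n" "j < n" for i j
  proof -
    have "(mat_adjoint W * W) $$ (i,j) =
        (\<Sum>k<n. cnj (ws ! i $ k / of_real (sqrt (r i))) * (ws ! j $ k / of_real (sqrt (r j))))"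
      using ij W by (simp add: scalar_prod_def W_def atLeast0LessThan)
    also have "\<dots> = (ws ! j \<bullet>c ws ! i) / of_real (sqrt (r i) * sqrt (r j))"
      using wsc[OF ij(1)] wsc[OF ij(2)]
      by (simp add: scalar_prod_def atLeast0LessThan sum_divide_distrib mult_ac)
    also have "\<dots> = (1\<^sub>m n) $$ (i,j)"
    proof (cases "i = j")
      case True
      thus ?thesis using r[OF ij(1)] ij by (simp del: of_real_mult add: of_real_mult[symmetric])
    next
      case False
      thus ?thesis using corthogonalD[OF ws(1), of j i] ij ws(3) by auto
    qed
    finally show ?thesis .
  qed
  hence 1: "mat_adjoint W * W = 1\<^sub>m n" using W by (intro eq_matI) auto
  have 2: "col W 0 = (1 / of_real (sqrt (r 0))) \<cdot>\<^sub>v v"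
    using n v by (intro eq_vecI) (auto simp: W_def ws0)
  show ?thesis by (rule that[OF W 1 2])
qed

text \<open>Induction on the size. Conjugating by a unitary matrix whose first column is an eigenvector for the
  eigenvalue \<open>e\<close> clears the rest of the first column; as the result is still Hermitian, the rest of
  the first row vanishes as well and \<open>e\<close> is real, which leaves a smaller Hermitian block.\<close>

theorem hermitian_spectral_decomposition:
  assumes "A \<in> hermitian_mats n"
  obtains U d where "U \<in> carrier_mat n n" "mat_adjoint U * U = 1\<^sub>m n" "U * mat_adjoint U = 1\<^sub>m n"
    "A = U * mat_diag n (\<lambda>i. complex_of_real (d i)) * mat_adjoint U"
proof -
  have "\<exists>U d. U \<in> carrier_mat n n \<and> mat_adjoint U * U = 1\<^sub>m n \<and>
    A = U * mat_diag n (\<lambda>i. complex_of_real (d i)) * mat_adjoint U"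
    using assms
  proof (induction n arbitrary: A)
    case 0
    show ?case
      by (rule exI[of _ "1\<^sub>m 0"], rule exI[of _ "\<lambda>_. 0"])
        (use 0 in \<open>auto simp: hermitian_mats_def mat_diag_def intro!: eq_matI\<close>)
  next
    case (Suc n A)
    let ?N = "Suc n"
    note A = hermitian_matsD[OF Suc.prems]
    obtain as where as: "char_poly A = (\<Prod>a\<leftarrow>as. [:- a, 1:])" "length as = ?N"
      using char_poly_factorized[OF A(1)] by auto
    then obtain e es where "as = e # es" by (cases as) auto
    hence "eigenvalue A e" using as(1) by (simp add: eigenvalue_root_char_poly[OF A(1)])
    then obtain v where v: "v \<in> carrier_vec ?N" "v \<noteq> 0\<^sub>v ?N" "A *\<^sub>v v = e \<cdot>\<^sub>v v"
      using A(1) by (auto simp: eigenvalue_def eigenvector_def)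
    obtain W c where W: "W \<in> carrier_mat ?N ?N" "mat_adjoint W * W = 1\<^sub>m ?N" "col W 0 = c \<cdot>\<^sub>v v"
      using unitary_with_first_column[OF v(1,2)] .
    have WW: "W * mat_adjoint W = 1\<^sub>m ?N"
      by (rule mat_mult_left_right_inverse[OF _ W(1,2)]) (use W(1) in simp)
    note [simp] = assoc_mult_mat[of _ ?N ?N _ ?N _ ?N] mult_carrier_mat[of _ ?N ?N _ ?N]
    define B where "B = mat_adjoint W * A * W"
    have B: "B \<in> hermitian_mats ?N"
      using hermitian_mats_congruence[OF Suc.prems, of "mat_adjoint W" ?N] W(1) by (simp add: B_def)
    \<comment> \<open>In the new basis the eigenvector is a multiple of the first unit vector.\<close>
    have col0: "col B 0 = e \<cdot>\<^sub>v col (1\<^sub>m ?N) 0"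
    proof -
      have WA: "mat_adjoint W * A \<in> carrier_mat ?N ?N" using W(1) A(1) by simp
      have W0: "col W 0 \<in> carrier_vec ?N" using W(1) by (intro carrier_vecI) simp
      have "col B 0 = (mat_adjoint W * A) *\<^sub>v col W 0"
        unfolding B_def by (rule col_mult2[OF WA W(1)]) simp
      also have "\<dots> = mat_adjoint W *\<^sub>v (A *\<^sub>v col W 0)"
        by (rule assoc_mult_mat_vec[OF _ A(1) W0]) (use W(1) in simp)
      also have "A *\<^sub>v col W 0 = e \<cdot>\<^sub>v col W 0"
        using A v by (simp add: W(3) mult_mat_vec[of _ ?N ?N] smult_smult_assoc mult.commute)
      also have "mat_adjoint W *\<^sub>v (e \<cdot>\<^sub>v col W 0) = e \<cdot>\<^sub>v (mat_adjoint W *\<^sub>v col W 0)"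
        using W(1) by (intro mult_mat_vec[of _ ?N ?N] carrier_vecI) auto
      also have "mat_adjoint W *\<^sub>v col W 0 = col (mat_adjoint W * W) 0"
        using W(1) by (intro col_mult2[symmetric, of _ ?N ?N _ ?N]) auto
      finally show ?thesis using W(2) by simp
    qed
    have B0: "B $$ (i, 0) = (if i = 0 then e else 0)" if "i < ?N" for i
      using arg_cong[OF col0, of "\<lambda>x. x $ i"] that hermitian_matsD(1)[OF B] by auto
    have B0': "B $$ (0, i) = (if i = 0 then e else 0)" if "i < ?N" for i
      using hermitian_mats_index[OF B, of 0 i] B0[OF that] B0[of 0] that by auto
    have "e = cnj e" using hermitian_mats_index[OF B, of 0 0] B0[of 0] by simp
    hence e: "complex_of_real (Re e) = e" by (simp add: complex_eq_iff)
    define C where "C = mat n n (\<lambda>(i,j). B $$ (Suc i, Suc j))"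
    have C: "C \<in> hermitian_mats n"
      by (auto simp: hermitian_mats_def C_def hermitian_mats_index[OF B, symmetric])
    obtain V d where V: "V \<in> carrier_mat n n" "mat_adjoint V * V = 1\<^sub>m n"
      "C = V * mat_diag n (\<lambda>i. complex_of_real (d i)) * mat_adjoint V"
      using Suc.IH[OF C] by auto
    \<comment> \<open>A unitary diagonalizing the lower right block, extended by the identity, leaves the first
      row and column of \<open>B\<close> as they are.\<close>
    define V' where "V' = four_block_mat (1\<^sub>m 1) (0\<^sub>m 1 n) (0\<^sub>m n 1) V"
    define d' where "d' i = (case i of 0 \<Rightarrow> Re e | Suc i \<Rightarrow> d i)" for i
    let ?D = "mat_diag ?N (\<lambda>i. complex_of_real (d' i))"
    have V': "V' \<in> carrier_mat ?N ?N"
      using four_block_carrier_mat[of "1\<^sub>m 1" 1 1 V n n] V(1) by (simp add: V'_def)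
    have V'adj: "mat_adjoint V' = four_block_mat (1\<^sub>m 1) (0\<^sub>m 1 n) (0\<^sub>m n 1) (mat_adjoint V)"
      using V(1) unfolding V'_def by (subst mat_adjoint_four_block[of _ 1 1 _ n _ n]) auto
    have V'V': "mat_adjoint V' * V' = 1\<^sub>m ?N"
      unfolding V'adj unfolding V'_def using V(1,2)
      by (subst mult_four_block_mat[of _ 1 1 _ n _ n _ _ 1 _ n]) auto
    have D: "?D = four_block_mat (mat 1 1 (\<lambda>_. e)) (0\<^sub>m 1 n) (0\<^sub>m n 1)
        (mat_diag n (\<lambda>i. complex_of_real (d i)))"
      by (rule eq_matI) (auto simp: mat_diag_def d'_def e split: nat.split)
    have "B = four_block_mat (mat 1 1 (\<lambda>_. e)) (0\<^sub>m 1 n) (0\<^sub>m n 1) C"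
      by (rule eq_matI) (use hermitian_matsD(1)[OF B] B0 B0' in \<open>auto simp: C_def\<close>)
    also have "\<dots> = V' * ?D * mat_adjoint V'"
    proof -
      have "V' * ?D = four_block_mat (mat 1 1 (\<lambda>_. e)) (0\<^sub>m 1 n) (0\<^sub>m n 1)
          (V * mat_diag n (\<lambda>i. complex_of_real (d i)))"
        unfolding V'_def D using V(1)
        by (subst mult_four_block_mat[of _ 1 1 _ n _ n _ _ 1 _ n]) (auto simp: mat_diag_def)
      moreover have "\<dots> * mat_adjoint V' = four_block_mat (mat 1 1 (\<lambda>_. e)) (0\<^sub>m 1 n) (0\<^sub>m n 1)
          (V * mat_diag n (\<lambda>i. complex_of_real (d i)) * mat_adjoint V)"
        unfolding V'adj using V(1)
        by (subst mult_four_block_mat[of _ 1 1 _ n _ n _ _ 1 _ n]) (auto simp: mat_diag_def)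
      ultimately show ?thesis by (simp only: V(3))
    qed
    finally have BV: "B = V' * ?D * mat_adjoint V'" .
    have "A = (W * mat_adjoint W) * A * (W * mat_adjoint W)" using A WW by simp
    also have "\<dots> = W * B * mat_adjoint W" using A W(1) unfolding B_def by simp
    also have "\<dots> = (W * V') * ?D * mat_adjoint (W * V')"
      unfolding BV mat_adjoint_mult[OF W(1) V'] using W(1) V' by simp
    finally have 1: "A = (W * V') * ?D * mat_adjoint (W * V')" .
    have "mat_adjoint (W * V') * (W * V') = mat_adjoint V' * (mat_adjoint W * W) * V'"
      unfolding mat_adjoint_mult[OF W(1) V'] using W(1) V' by simp
    also have "\<dots> = 1\<^sub>m ?N" using V'V' V' W(2) by simp
    finally have 2: "mat_adjoint (W * V') * (W * V') = 1\<^sub>m ?N" .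
    show ?case
      by (rule exI[of _ "W * V'"], rule exI[of _ d']) (use 1 2 W(1) V' in auto)
  qed
  then obtain U d where "U \<in> carrier_mat n n" "mat_adjoint U * U = 1\<^sub>m n"
    "A = U * mat_diag n (\<lambda>i. complex_of_real (d i)) * mat_adjoint U" by auto
  moreover from this(1,2) have "U * mat_adjoint U = 1\<^sub>m n"
    by (intro mat_mult_left_right_inverse[of "mat_adjoint U" n U]) auto
  ultimately show ?thesis using that by blast
qed

text \<open>Products of matrices diagonalized by the same unitary matrix are computed on the eigenvalues; this
  reduces the Penrose equations to identities between real numbers.\<close>

lemma unitary_diag_mult:
  fixes U :: "complex mat"
  assumes "U \<in> carrier_mat n n" "mat_adjoint U * U = 1\<^sub>m n"
  shows "(U * mat_diag n f * mat_adjoint U) * (U * mat_diag n g * mat_adjoint U) =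
    U * mat_diag n (\<lambda>i. f i * g i) * mat_adjoint U"
proof -
  have "(U * mat_diag n f * mat_adjoint U) * (U * mat_diag n g * mat_adjoint U) =
    U * (mat_diag n f * (mat_adjoint U * U) * mat_diag n g) * mat_adjoint U"
    using assms(1) by (simp add: assoc_mult_mat[of _ n n _ n _ n] mult_carrier_mat[of _ n n _ n])
  thus ?thesis by (simp add: assms(2) right_mult_one_mat[of _ n n])
qed

section \<open>Moore-Penrose inverse and range of a Hermitian matrix\<close>

text \<open>Two Moore-Penrose inverses give the same orthogonal projections: \<open>A G\<close> and \<open>A H\<close> both project onto
  the range of \<open>A\<close>, and \<open>G A\<close> and \<open>H A\<close> both project along its kernel. Then
  \<open>G = G A G = G A H = H A H = H\<close>.\<close>

lemma mp_inverse_unique: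
  assumes "is_mp_inverse A G" "is_mp_inverse A H"
  shows "G = H"
proof -
  define m n where "m = dim_row A" and "n = dim_col A"
  have A: "A \<in> carrier_mat m n" by (auto simp: m_def n_def)
  have G: "G \<in> carrier_mat n m" "A * G * A = A" "G * A * G = G"
      "mat_adjoint (A * G) = A * G" "mat_adjoint (G * A) = G * A"
    and H: "H \<in> carrier_mat n m" "A * H * A = A" "H * A * H = H"
      "mat_adjoint (A * H) = A * H" "mat_adjoint (H * A) = H * A"
    using assms by (auto simp: is_mp_inverse_def m_def n_def)
  have "A * G = (A * H) * (A * G)"
    using assoc_mult_mat[of "A * H" m m A n G m] A G(1) H(1,2) by simp
  hence "mat_adjoint (A * G) = mat_adjoint ((A * H) * (A * G))" by simp
  also have "\<dots> = mat_adjoint (A * G) * mat_adjoint (A * H)"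
    by (rule mat_adjoint_mult[of _ m m _ m]) (use A G(1) H(1) in auto)
  also have "\<dots> = (A * G) * (A * H)" by (simp only: G(4) H(4))
  also have "\<dots> = A * G * A * H"
    by (rule assoc_mult_mat[symmetric, of _ m m _ n _ m]) (use A G(1) H(1) in auto)
  finally have AG: "A * G = A * H" by (simp only: G(2,4))
  have "G * A = (G * A) * (H * A)"
    using assoc_mult_mat[of G n m "A * H" m A n] assoc_mult_mat[of A m n H m A n]
      assoc_mult_mat[of G n m A n "H * A" n] A G(1) H(1,2) by simp
  hence "mat_adjoint (G * A) = mat_adjoint ((G * A) * (H * A))" by simp
  also have "\<dots> = mat_adjoint (H * A) * mat_adjoint (G * A)"
    by (rule mat_adjoint_mult[of _ n n _ n]) (use A G(1) H(1) in auto)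
  also have "\<dots> = (H * A) * (G * A)" by (simp only: G(5) H(5))
  also have "\<dots> = H * (A * G * A)"
    using assoc_mult_mat[of H n m A n "G * A" n] assoc_mult_mat[of A m n G m A n] A G(1) H(1)
    by simp
  finally have GA: "G * A = H * A" by (simp only: G(2,5))
  have "G = G * (A * H)"
    using G(3) AG assoc_mult_mat[of G n m A n G m] A G(1) by simp
  also have "\<dots> = G * A * H"
    by (rule assoc_mult_mat[symmetric]) (use A G(1) H(1) in auto)
  also have "\<dots> = H" by (simp only: GA H(3))
  finally show ?thesis .
qed

text \<open>Inverting the nonzero eigenvalues in a spectral decomposition yields a Moore-Penrose inverse, and
  this one is visibly Hermitian.\<close>

theorem hermitian_mp_inverse:
  assumes "K \<in> hermitian_mats n"
  shows "is_mp_inverse K (mp_inverse K)" "mp_inverse K \<in> hermitian_mats n"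
proof -
  obtain U d where U: "U \<in> carrier_mat n n" "mat_adjoint U * U = 1\<^sub>m n" "U * mat_adjoint U = 1\<^sub>m n"
    and K: "K = U * mat_diag n (\<lambda>i. complex_of_real (d i)) * mat_adjoint U"
    using hermitian_spectral_decomposition[OF assms] .
  let ?F = "\<lambda>f. U * mat_diag n (\<lambda>i. complex_of_real (f i)) * mat_adjoint U"
  have F: "?F f \<in> hermitian_mats n" for f
    by (rule hermitian_mats_congruence[OF mat_diag_of_real_hermitian U(1)])
  have mult: "?F f * ?F g = ?F (\<lambda>i. f i * g i)" for f g
    unfolding unitary_diag_mult[OF U(1,2)] by simp
  \<comment> \<open>The convention \<open>inverse 0 = 0\<close> makes \<open>inverse\<close> the scalar Moore-Penrose inverse, so zero
    eigenvalues need no separate treatment.\<close>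
  have inv: "x * inverse x * x = x" "inverse x * x * inverse x = inverse x" for x :: real
    by (cases "x = 0"; simp)+
  let ?G = "?F (\<lambda>i. inverse (d i))"
  have "K * ?G * K = K" "?G * K * ?G = ?G"
    by (simp_all only: K mult inv)
  moreover have "mat_adjoint (K * ?G) = K * ?G" "mat_adjoint (?G * K) = ?G * K"
    by (simp_all only: K mult hermitian_matsD(2)[OF F])
  moreover have "?G \<in> carrier_mat (dim_col K) (dim_row K)"
    using hermitian_matsD(1)[OF F[of "\<lambda>i. inverse (d i)"]] hermitian_matsD(1)[OF assms]
    by (simp only: carrier_matD)
  ultimately have G: "is_mp_inverse K ?G" unfolding is_mp_inverse_def by blast
  have "mp_inverse K = ?F (\<lambda>i. inverse (d i))"
    unfolding mp_inverse_def by (rule the_equality, rule G, rule mp_inverse_unique[OF _ G])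
  thus "is_mp_inverse K (mp_inverse K)" "mp_inverse K \<in> hermitian_mats n"
    using G F by (simp_all only:)
qed

lemma mat_range_iff:
  assumes "A \<in> carrier_mat m n"
  shows "v \<in> mat_range A \<longleftrightarrow> v \<in> carrier_vec m \<and> (\<exists>x \<in> carrier_vec n. A *\<^sub>v x = v)"
proof -
  interpret vec_space "TYPE(complex)" m .
  show ?thesis using col_space_eq[of A n] assms by auto
qed

lemma mp_inverse_solves:
  assumes K: "K \<in> hermitian_mats n" and v: "v \<in> mat_range K"
  shows "K *\<^sub>v (mp_inverse K *\<^sub>v v) = v"
proof -
  note Kc = hermitian_matsD(1)[OF K] and G = hermitian_mp_inverse[OF K]
  note Gc = hermitian_matsD(1)[OF G(2)]
  obtain x where x: "x \<in> carrier_vec n" "v = K *\<^sub>v x"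
    using v by (auto simp: mat_range_iff[OF Kc])
  have "K *\<^sub>v (mp_inverse K *\<^sub>v v) = (K * mp_inverse K * K) *\<^sub>v x"
    using Kc Gc x by (simp add: assoc_mult_mat_vec[of _ n n _ n] x(2))
  also have "\<dots> = v" using G(1) x(2) by (simp add: is_mp_inverse_def)
  finally show ?thesis .
qed

text \<open>The Fredholm alternative. It turns range inclusions into kernel inclusions, which the quadratic
  forms can decide.\<close>

lemma hermitian_range_iff_orthogonal_kernel:
  assumes K: "K \<in> hermitian_mats n" and v: "v \<in> carrier_vec n"
  shows "v \<in> mat_range K \<longleftrightarrow> (\<forall>z \<in> carrier_vec n. K *\<^sub>v z = 0\<^sub>v n \<longrightarrow> v \<bullet>c z = 0)"
proof
  note Kc = hermitian_matsD[OF K]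
  have adj: "(K *\<^sub>v x) \<bullet>c z = 0" if "x \<in> carrier_vec n" "z \<in> carrier_vec n" "K *\<^sub>v z = 0\<^sub>v n" for x z
    using mult_mat_vec_cscalar_adjoint[OF Kc(1) that(1,2)] that Kc(2) by simp
  show "\<forall>z \<in> carrier_vec n. K *\<^sub>v z = 0\<^sub>v n \<longrightarrow> v \<bullet>c z = 0" if "v \<in> mat_range K"
    using that adj by (auto simp: mat_range_iff[OF Kc(1)])
  assume orth: "\<forall>z \<in> carrier_vec n. K *\<^sub>v z = 0\<^sub>v n \<longrightarrow> v \<bullet>c z = 0"
  note G = hermitian_mp_inverse[OF K]
  note Gc = hermitian_matsD[OF G(2)]
  let ?G = "mp_inverse K"
  have KGK: "K * ?G * K = K" and KG: "mat_adjoint (K * ?G) = K * ?G"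
    using G(1) by (auto simp: is_mp_inverse_def)
  have "K * ?G = ?G * K"
    using KG mat_adjoint_mult[OF Kc(1) Gc(1)] Kc(2) Gc(2) by simp
  hence KKG: "K * (K * ?G) = K"
    using KGK assoc_mult_mat[OF Kc(1) Gc(1) Kc(1)] by simp
  \<comment> \<open>The residual of the least squares solution \<open>y\<close> lies in the kernel, hence is orthogonal to \<open>v\<close>;
    it is also orthogonal to the range, hence to itself.\<close>
  define y where "y = ?G *\<^sub>v v"
  define z where "z = v - K *\<^sub>v y"
  have y: "y \<in> carrier_vec n" and z: "z \<in> carrier_vec n" and Ky: "K *\<^sub>v y \<in> carrier_vec n"
    using Kc Gc v by (auto simp: y_def z_def)
  have "K *\<^sub>v (K *\<^sub>v y) = (K * (K * ?G)) *\<^sub>v v"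
    using Kc Gc v by (simp add: assoc_mult_mat_vec[of _ n n _ n] y_def)
  hence Kz: "K *\<^sub>v z = 0\<^sub>v n"
    using Kc v Ky unfolding z_def KKG by (simp add: mult_minus_distrib_mat_vec[of _ n n])
  have "z \<bullet>c z = v \<bullet>c z - (K *\<^sub>v y) \<bullet>c z"
    unfolding z_def using v Ky by (intro minus_scalar_prod_distrib[of _ n]) auto
  also have "\<dots> = 0" using orth z Kz adj[OF y z Kz] by simp
  finally have z0: "z = 0\<^sub>v n" using z by simp
  have "v = K *\<^sub>v y"
  proof (rule eq_vecI)
    show "v $ i = (K *\<^sub>v y) $ i" if "i < dim_vec (K *\<^sub>v y)" for i
      using arg_cong[OF z0, of "\<lambda>u. u $ i"] that Ky Kc(1) by (simp add: z_def)
  qed (use v Ky Kc(1) in simp)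
  thus "v \<in> mat_range K" using v y by (auto simp: mat_range_iff[OF Kc(1)])
qed

section \<open>The Loewner order\<close>

lemma loewner_ge_iff:
  assumes P: "P \<in> hermitian_mats n" and Q: "Q \<in> hermitian_mats n"
  shows "P \<succeq> Q \<longleftrightarrow> (\<forall>v \<in> carrier_vec n. (Q *\<^sub>v v) \<bullet>c v \<le> (P *\<^sub>v v) \<bullet>c v)"
proof -
  note Pc = hermitian_matsD(1)[OF P] and Qc = hermitian_matsD(1)[OF Q]
  have "((P - Q) *\<^sub>v v) \<bullet>c v = (P *\<^sub>v v) \<bullet>c v - (Q *\<^sub>v v) \<bullet>c v" if "v \<in> carrier_vec n" for v
    using Pc Qc that by (simp add: minus_mult_distrib_mat_vec[of _ n n] minus_scalar_prod_distrib[of _ n])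
  thus ?thesis
    using P Q Pc Qc hermitian_mats_minus[OF P Q]
    by (auto simp: loewner_ge_def positive_semidefinite_def)
qed

lemma minus_loewner_ge_iff:
  assumes A: "A \<in> hermitian_mats n" and P: "P \<in> hermitian_mats n" and Q: "Q \<in> hermitian_mats n"
  shows "A - P \<succeq> A - Q \<longleftrightarrow> Q \<succeq> P"
proof -
  note c = hermitian_matsD(1)[OF A] hermitian_matsD(1)[OF P] hermitian_matsD(1)[OF Q]
  have "(A - P) - (A - Q) = Q - P" by (rule eq_matI) (use c in auto)
  thus ?thesis
    using c P Q hermitian_mats_minus[OF A P] hermitian_mats_minus[OF A Q] by (simp add: loewner_ge_def)
qed

text \<open>If \<open>v\<^sup>* Y v = 0\<close> but \<open>w = Y v\<close> is nonzero, the form \<open>Y\<close> decreases to first order when \<open>v\<close> moves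
  in the direction \<open>- w\<close>, and so becomes negative.\<close>

lemma psd_quadratic_form_zero:
  assumes psd: "positive_semidefinite Y" and Y: "Y \<in> carrier_mat n n"
    and v: "v \<in> carrier_vec n" and zero: "(Y *\<^sub>v v) \<bullet>c v = 0"
  shows "Y *\<^sub>v v = 0\<^sub>v n"
proof (rule ccontr)
  assume nz: "Y *\<^sub>v v \<noteq> 0\<^sub>v n"
  have Yh: "mat_adjoint Y = Y" and pos: "\<And>x. x \<in> carrier_vec n \<Longrightarrow> 0 \<le> (Y *\<^sub>v x) \<bullet>c x"
    using psd Y by (auto simp: positive_semidefinite_def hermitian_mats_def)
  define w where "w = Y *\<^sub>v v"
  have w: "w \<in> carrier_vec n" and Yw: "Y *\<^sub>v w \<in> carrier_vec n" using Y v by (auto simp: w_def)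
  define a b where "a = Re (w \<bullet>c w)" and "b = Re ((Y *\<^sub>v w) \<bullet>c w)"
  have "0 < w \<bullet>c w" using w nz w_def by simp
  hence a: "w \<bullet>c w = of_real a" "0 < a" by (auto simp: a_def less_complex_def complex_eq_iff)
  have b: "(Y *\<^sub>v w) \<bullet>c w = of_real b" "0 \<le> b"
    using pos[OF w] by (auto simp: b_def less_eq_complex_def complex_eq_iff)
  \<comment> \<open>The form at \<open>v + t w\<close> is \<open>2 a t + b t\<^sup>2\<close>; this \<open>t\<close> lies between \<open>0\<close> and the
    minimizer \<open>- a / b\<close>, where the value is negative, and it makes sense for \<open>b = 0\<close> too.\<close>
  define t where "t = - a / (b + 1)"
  let ?t = "complex_of_real t"
  define x where "x = v + ?t \<cdot>\<^sub>v w"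
  have x: "x \<in> carrier_vec n" using v w by (simp add: x_def)
  have Yx: "Y *\<^sub>v x = w + ?t \<cdot>\<^sub>v (Y *\<^sub>v w)"
    using Y v w by (simp add: x_def w_def mult_add_distrib_mat_vec[of _ n n] mult_mat_vec[of _ n n])
  have Ywv: "(Y *\<^sub>v w) \<bullet>c v = w \<bullet>c w"
    using mult_mat_vec_cscalar_adjoint[OF Y w v] by (simp add: Yh w_def)
  have cx: "conjugate x = conjugate v + ?t \<cdot>\<^sub>v conjugate w"
    using v w by (simp add: x_def conjugate_add_vec[of _ n] conjugate_smult_vec)
  have "(Y *\<^sub>v x) \<bullet>c x = w \<bullet>c v + ?t * (w \<bullet>c w) + (?t * ((Y *\<^sub>v w) \<bullet>c v) + ?t * (?t * ((Y *\<^sub>v w) \<bullet>c w)))"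
    unfolding Yx cx using v w Yw
    by (simp add: add_scalar_prod_distrib[of _ n] scalar_prod_add_distrib[of _ n] algebra_simps)
  also have "\<dots> = of_real (t * (2 * a + t * b))"
    unfolding Ywv a(1) b(1) using zero by (simp add: w_def algebra_simps)
  finally have "0 \<le> t * (2 * a + t * b)"
    using pos[OF x] by (simp add: less_eq_complex_def)
  moreover have "t < 0" using a(2) b(2) by (simp add: t_def)
  moreover have "0 < 2 * a + t * b"
  proof -
    have "2 * a + t * b = a * (b + 2) / (b + 1)" using b(2) by (simp add: t_def field_simps)
    thus ?thesis using a(2) b(2) by simp
  qed
  ultimately show False by (meson linorder_not_less mult_neg_pos)
qed

lemma outer_product_hermitian:
  "mat n n (\<lambda>(i,j). x $ i * cnj (x $ j)) \<in> hermitian_mats n"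
  by (auto simp: hermitian_mats_def intro!: eq_matI)

lemma outer_product_quadratic_form:
  fixes x :: "complex vec"
  assumes "x \<in> carrier_vec n" "v \<in> carrier_vec n"
  shows "(mat n n (\<lambda>(i,j). x $ i * cnj (x $ j)) *\<^sub>v v) \<bullet>c v = (v \<bullet>c x) * (x \<bullet>c v)"
  using assms
  by (auto simp: scalar_prod_def sum_distrib_left sum_distrib_right mult_ac intro!: sum.cong)

section \<open>Inertia\<close>

text \<open>The only dimension count behind Sylvester's law.\<close>

lemma homogeneous_system_nontrivial_solution:
  fixes rs :: "'a :: field vec list"
  assumes rs: "set rs \<subseteq> carrier_vec n" and len: "length rs < n"
  obtains x where "x \<in> carrier_vec n" "x \<noteq> 0\<^sub>v n" "\<And>r. r \<in> set rs \<Longrightarrow> r \<bullet> x = 0"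
proof -
  \<comment> \<open>Padding with zero rows gives a square matrix, singular because its last row vanishes.\<close>
  define R where "R = mat n n (\<lambda>(i,j). if i < length rs then rs ! i $ j else 0)"
  have R: "R \<in> carrier_mat n n" by (simp add: R_def)
  have "R\<^sup>T *\<^sub>v unit_vec n (n - 1) = 0\<^sub>v n"
  proof (rule eq_vecI)
    fix i assume "i < dim_vec (0\<^sub>v n :: 'a vec)"
    thus "(R\<^sup>T *\<^sub>v unit_vec n (n - 1)) $ i = 0\<^sub>v n $ i"
      using len by (auto simp: R_def)
  qed (simp add: R_def)
  moreover have "unit_vec n (n - 1) \<noteq> (0\<^sub>v n :: 'a vec)"
    using len arg_cong[of "unit_vec n (n - 1) :: 'a vec" "0\<^sub>v n" "\<lambda>v. v $ (n - 1)"] by auto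
  ultimately have "det (R\<^sup>T) = 0"
    using R unfolding det_0_iff_vec_prod_zero_field[OF transpose_carrier_mat[THEN iffD2, OF R]]
    by (intro exI[of _ "unit_vec n (n - 1)"]) simp
  hence "det R = 0" using det_transpose[OF R] by simp
  then obtain x where x: "x \<in> carrier_vec n" "x \<noteq> 0\<^sub>v n" "R *\<^sub>v x = 0\<^sub>v n"
    using det_0_iff_vec_prod_zero_field[OF R] by auto
  have "r \<bullet> x = 0" if r: "r \<in> set rs" for r
  proof -
    obtain i where i: "i < length rs" "r = rs ! i" using r by (auto simp: in_set_conv_nth)
    have "r \<in> carrier_vec n" using r rs by auto
    hence "row R i = r" by (intro eq_vecI) (use i len in \<open>auto simp: R_def\<close>)
    thus ?thesis using arg_cong[OF x(3), of "\<lambda>v. v $ i"] i len R by auto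
  qed
  thus ?thesis using that x by blast
qed

lemma order_prod_linear_factors:
  fixes f :: "nat \<Rightarrow> 'a :: idom"
  shows "order a (\<Prod>x\<leftarrow>map f [0..<n]. [:- x, 1:]) = card {i. i < n \<and> f i = a}"
proof (induction n)
  case 0
  show ?case by simp
next
  case (Suc n)
  have nz: "(\<Prod>x\<leftarrow>map f [0..<n]. [:- x, 1:]) \<noteq> 0" for n
    by (auto simp: prod_list_zero_iff)
  have "order a (\<Prod>x\<leftarrow>map f [0..<Suc n]. [:- x, 1:]) =
      card {i. i < n \<and> f i = a} + order a [:- f n, 1:]"
  proof -
    have "(\<Prod>x\<leftarrow>map f [0..<Suc n]. [:- x, 1:]) = (\<Prod>x\<leftarrow>map f [0..<n]. [:- x, 1:]) * [:- f n, 1:]"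
      by (simp del: mult_pCons_right)
    moreover have "(\<Prod>x\<leftarrow>map f [0..<n]. [:- x, 1:]) * [:- f n, 1:] \<noteq> 0"
      using nz[of n] by (simp del: mult_pCons_right)
    ultimately show ?thesis using Suc.IH by (simp add: order_mult del: mult_pCons_right)
  qed
  also have "\<dots> = card {i. i < Suc n \<and> f i = a}"
  proof (cases "f n = a")
    case True
    hence "{i. i < Suc n \<and> f i = a} = insert n {i. i < n \<and> f i = a}" by (auto simp: less_Suc_eq)
    moreover have "order a [:- f n, 1:] = 1" using order_power_n_n[of a 1] True by simp
    ultimately show ?thesis by simp
  next
    case False
    hence "{i. i < Suc n \<and> f i = a} = {i. i < n \<and> f i = a}" by (auto simp: less_Suc_eq)
    moreover have "order a [:- f n, 1:] = 0" using False by (intro order_0I) simp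
    ultimately show ?thesis by simp
  qed
  finally show ?case .
qed

context
  fixes A U :: "complex mat" and d :: "nat \<Rightarrow> real" and n :: nat
  assumes U: "U \<in> carrier_mat n n" "mat_adjoint U * U = 1\<^sub>m n" "U * mat_adjoint U = 1\<^sub>m n"
    and A: "A = U * mat_diag n (\<lambda>i. complex_of_real (d i)) * mat_adjoint U"
begin

lemma unitary_diag_char_poly:
  "char_poly A = (\<Prod>x\<leftarrow>map (\<lambda>i. complex_of_real (d i)) [0..<n]. [:- x, 1:])"
proof -
  let ?D = "mat_diag n (\<lambda>i. complex_of_real (d i))"
  have "similar_mat_wit A ?D U (mat_adjoint U)"
    using U by (intro similar_mat_witI[of _ _ n]) (auto simp: A intro!: mult_carrier_mat[of _ n n])
  hence "char_poly A = char_poly ?D" by (intro char_poly_similar) (auto simp: similar_mat_def)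
  also have "\<dots> = (\<Prod>x\<leftarrow>diag_mat ?D. [:- x, 1:])"
    by (rule char_poly_upper_triangular[of _ n]) (auto simp: mat_diag_def)
  also have "diag_mat ?D = map (\<lambda>i. complex_of_real (d i)) [0..<n]"
    by (auto simp: diag_mat_def mat_diag_def)
  finally show ?thesis .
qed

text \<open>The property \<open>P\<close> is left general so that both indices of inertia are instances.\<close>

lemma unitary_diag_sum_orders:
  "(\<Sum>x\<in>{x :: real. P x \<and> eigenvalue A (of_real x)}. order (of_real x) (char_poly A)) =
    card {i. i < n \<and> P (d i)}"
proof -
  have Ac: "A \<in> carrier_mat n n"
    unfolding A using U(1) by (auto intro!: mult_carrier_mat[of _ n n])
  have ord: "order (of_real x) (char_poly A) = card {i. i < n \<and> d i = x}" for x
    unfolding unitary_diag_char_poly order_prod_linear_factors by simp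
  have S: "{x. P x \<and> eigenvalue A (of_real x)} = d ` {i. i < n \<and> P (d i)}"
    by (auto simp: eigenvalue_root_char_poly[OF Ac] unitary_diag_char_poly poly_prod_list prod_list_zero_iff)
  have "(\<Sum>x\<in>d ` {i. i < n \<and> P (d i)}. card {i. i < n \<and> d i = x}) =
      card (\<Union>x\<in>d ` {i. i < n \<and> P (d i)}. {i. i < n \<and> d i = x})"
    by (rule card_UN_disjoint[symmetric]) auto
  also have "(\<Union>x\<in>d ` {i. i < n \<and> P (d i)}. {i. i < n \<and> d i = x}) = {i. i < n \<and> P (d i)}"
    by auto
  finally show ?thesis by (simp add: S ord)
qed

lemma inertia_unitary_diag:
  "inertia_pos A = card {i. i < n \<and> 0 < d i}" "inertia_neg A = card {i. i < n \<and> d i < 0}"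
  unfolding inertia_pos_def inertia_neg_def by (rule unitary_diag_sum_orders)+

lemma unitary_diag_quadratic_form:
  assumes v: "v \<in> carrier_vec n"
  shows "(A *\<^sub>v v) \<bullet>c v = of_real (\<Sum>i<n. d i * (cmod ((mat_adjoint U *\<^sub>v v) $ i))\<^sup>2)"
proof -
  let ?y = "mat_adjoint U *\<^sub>v v"
  let ?D = "mat_diag n (\<lambda>i. complex_of_real (d i))"
  have y: "?y \<in> carrier_vec n" using U(1) v by (intro mult_mat_vec_carrier[of _ n n]) auto
  have "(A *\<^sub>v v) \<bullet>c v = (?D *\<^sub>v ?y) \<bullet>c ?y"
    unfolding A by (rule quadratic_form_congruence[OF mat_diag_dim U(1) v])
  also have "\<dots> = (\<Sum>i<n. d i * ?y $ i * cnj (?y $ i))"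
    unfolding mat_diag_mult_vec[OF y] using y U(1)
    by (auto simp: scalar_prod_def atLeast0LessThan simp del: index_mult_mat_vec intro!: sum.cong)
  also have "\<dots> = of_real (\<Sum>i<n. d i * (cmod (?y $ i))\<^sup>2)"
    by (simp add: mult.assoc complex_norm_square[symmetric] del: index_mult_mat_vec)
  finally show ?thesis .
qed

lemma uminus_unitary_diag: "- A = U * mat_diag n (\<lambda>i. complex_of_real (- d i)) * mat_adjoint U"
proof -
  have "mat_diag n (\<lambda>i. complex_of_real (- d i)) = - mat_diag n (\<lambda>i. complex_of_real (d i))"
    by (rule eq_matI) (auto simp: mat_diag_def)
  thus ?thesis
    unfolding A using U(1) carrier_matD[OF mat_diag_dim, of n "\<lambda>i. complex_of_real (d i)"]
    by simp
qed

end

lemma inertia_neg_eq_inertia_pos_uminus: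
  assumes "A \<in> hermitian_mats n"
  shows "inertia_neg A = inertia_pos (- A)"
proof -
  obtain U d where U: "U \<in> carrier_mat n n" "mat_adjoint U * U = 1\<^sub>m n" "U * mat_adjoint U = 1\<^sub>m n"
    "A = U * mat_diag n (\<lambda>i. complex_of_real (d i)) * mat_adjoint U"
    using hermitian_spectral_decomposition[OF assms] .
  show ?thesis
    using inertia_unitary_diag(2)[OF U]
      inertia_unitary_diag(1)[OF U(1-3) uminus_unitary_diag[OF U]] by simp
qed

text \<open>Sylvester's law in one direction, for a rectangular \<open>T\<close>. If \<open>T A T\<^sup>*\<close> had more positive eigenvalues
  than \<open>A\<close>, a dimension count would give a nonzero vector \<open>x\<close> in the positive eigenspaces of
  \<open>T A T\<^sup>*\<close> for which \<open>T\<^sup>* x\<close> has no component in the positive eigenspaces of \<open>A\<close>; the common value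
  of the two quadratic forms would then be both positive and nonpositive.\<close>

lemma inertia_pos_congruence_le:
  assumes A: "A \<in> hermitian_mats m" and T: "T \<in> carrier_mat n m"
  shows "inertia_pos (T * A * mat_adjoint T) \<le> inertia_pos A"
proof (rule ccontr)
  let ?B = "T * A * mat_adjoint T"
  assume less: "\<not> inertia_pos ?B \<le> inertia_pos A"
  obtain U d where U: "U \<in> carrier_mat m m" "mat_adjoint U * U = 1\<^sub>m m" "U * mat_adjoint U = 1\<^sub>m m"
    "A = U * mat_diag m (\<lambda>i. complex_of_real (d i)) * mat_adjoint U"
    using hermitian_spectral_decomposition[OF A] .
  obtain V e where V: "V \<in> carrier_mat n n" "mat_adjoint V * V = 1\<^sub>m n" "V * mat_adjoint V = 1\<^sub>m n"
    "?B = V * mat_diag n (\<lambda>i. complex_of_real (e i)) * mat_adjoint V"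
    using hermitian_spectral_decomposition[OF hermitian_mats_congruence[OF A T]] .
  define P where "P = mat_adjoint U * mat_adjoint T"
  have P: "P \<in> carrier_mat m n" using U(1) T by (auto simp: P_def)
  \<comment> \<open>Fewer than \<open>n\<close> linear conditions on \<open>x\<close>: no component along the eigenvectors of \<open>T A T\<^sup>*\<close> with
    nonpositive eigenvalue, and none of \<open>T\<^sup>* x\<close> along the eigenvectors of \<open>A\<close> with positive one.\<close>
  define ps where "ps = filter (\<lambda>i. \<not> 0 < e i) [0..<n]"
  define js where "js = filter (\<lambda>i. 0 < d i) [0..<m]"
  define rs where "rs = map (row (mat_adjoint V)) ps @ map (row P) js"
  have rs: "set rs \<subseteq> carrier_vec n" using V(1) P by (auto simp: rs_def intro!: carrier_vecI)
  have js: "length js = inertia_pos A"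
  proof -
    have "length js = card (set js)" by (rule distinct_card[symmetric]) (simp add: js_def)
    also have "set js = {i. i < m \<and> 0 < d i}" by (auto simp: js_def)
    finally show ?thesis by (simp add: inertia_unitary_diag(1)[OF U])
  qed
  have "length ps = card (set ps)" by (rule distinct_card[symmetric]) (simp add: ps_def)
  also have "set ps = {..<n} - {i. i < n \<and> 0 < e i}" by (auto simp: ps_def)
  also have "card \<dots> = n - inertia_pos ?B"
    by (subst card_Diff_subset) (auto simp: inertia_unitary_diag(1)[OF V])
  finally have "length ps = n - inertia_pos ?B" .
  moreover have "inertia_pos ?B \<le> n"
    using card_mono[of "{..<n}" "{i. i < n \<and> 0 < e i}"] by (auto simp: inertia_unitary_diag(1)[OF V])
  ultimately have "length rs < n" using js less by (simp add: rs_def)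
  then obtain x where x: "x \<in> carrier_vec n" "x \<noteq> 0\<^sub>v n" "\<And>r. r \<in> set rs \<Longrightarrow> r \<bullet> x = 0"
    using homogeneous_system_nontrivial_solution[OF rs] by metis
  define y where "y = mat_adjoint V *\<^sub>v x"
  have y: "y \<in> carrier_vec n" unfolding y_def using V(1) x(1) by (intro mult_mat_vec_carrier[of _ n n]) auto
  have y0: "y $ i = 0" if "i < n" "\<not> 0 < e i" for i
    using x(3)[of "row (mat_adjoint V) i"] that V(1) by (auto simp: y_def rs_def ps_def)
  have Px0: "(P *\<^sub>v x) $ i = 0" if "i < m" "0 < d i" for i
    using x(3)[of "row P i"] that P by (auto simp: rs_def js_def)
  have Tx: "mat_adjoint T *\<^sub>v x \<in> carrier_vec m" using T x(1) by (intro mult_mat_vec_carrier[of _ m n]) auto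
  have Px: "P *\<^sub>v x = mat_adjoint U *\<^sub>v (mat_adjoint T *\<^sub>v x)"
    unfolding P_def using U(1) T x(1) by (intro assoc_mult_mat_vec[of _ m m _ n]) auto
  have "complex_of_real (\<Sum>i<n. e i * (cmod (y $ i))\<^sup>2) = (?B *\<^sub>v x) \<bullet>c x"
    unfolding y_def by (rule unitary_diag_quadratic_form[OF V x(1), symmetric])
  also have "\<dots> = (A *\<^sub>v (mat_adjoint T *\<^sub>v x)) \<bullet>c (mat_adjoint T *\<^sub>v x)"
    by (rule quadratic_form_congruence[OF hermitian_matsD(1)[OF A] T x(1)])
  also have "\<dots> = of_real (\<Sum>i<m. d i * (cmod ((P *\<^sub>v x) $ i))\<^sup>2)"
    unfolding Px by (rule unitary_diag_quadratic_form[OF U Tx])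
  finally have eq: "(\<Sum>i<n. e i * (cmod (y $ i))\<^sup>2) = (\<Sum>i<m. d i * (cmod ((P *\<^sub>v x) $ i))\<^sup>2)"
    by (simp only: of_real_eq_iff)
  \<comment> \<open>The common value is nonpositive when read off from \<open>A\<close>, but positive when read off from
    \<open>T A T\<^sup>*\<close>.\<close>
  have nonpos: "(\<Sum>i<m. d i * (cmod ((P *\<^sub>v x) $ i))\<^sup>2) \<le> 0"
  proof (rule sum_nonpos)
    fix i assume i: "i \<in> {..<m}"
    show "d i * (cmod ((P *\<^sub>v x) $ i))\<^sup>2 \<le> 0"
    proof (cases "0 < d i")
      case True
      thus ?thesis using Px0[of i] i by (simp del: index_mult_mat_vec)
    next
      case False
      thus ?thesis by (simp add: mult_nonpos_nonneg del: index_mult_mat_vec)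
    qed
  qed
  have "V *\<^sub>v y = (V * mat_adjoint V) *\<^sub>v x"
    unfolding y_def using V(1) x(1) by (intro assoc_mult_mat_vec[symmetric, of _ n n _ n]) auto
  hence Vy: "V *\<^sub>v y = x" using V(3) x(1) by simp
  have "\<exists>i<n. y $ i \<noteq> 0"
  proof (rule ccontr)
    assume "\<not> (\<exists>i<n. y $ i \<noteq> 0)"
    hence "y = 0\<^sub>v n" by (intro eq_vecI) (use y in auto)
    thus False using Vy x(2) mult_mat_zero_vec[OF V(1)] by simp
  qed
  then obtain i where i: "i < n" "y $ i \<noteq> 0" by auto
  have "0 < (\<Sum>i<n. e i * (cmod (y $ i))\<^sup>2)"
  proof (rule sum_pos2[of _ i])
    have "0 < e i" using i y0 by blast
    thus "0 < e i * (cmod (y $ i))\<^sup>2" using i(2) by simp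
    show "0 \<le> e j * (cmod (y $ j))\<^sup>2" if "j \<in> {..<n}" for j
      using that y0[of j] by (cases "0 < e j") auto
  qed (use i in auto)
  thus False using eq nonpos by simp
qed

text \<open>Apply the one-sided inequality to \<open>T\<close> and to its left inverse \<open>S\<close>. The negative index of \<open>A\<close> is the
  positive index of \<open>- A\<close>.\<close>

theorem sylvester_law_of_inertia:
  assumes A: "A \<in> hermitian_mats n" and T: "T \<in> carrier_mat n n" and S: "S \<in> carrier_mat n n"
    and ST: "S * T = 1\<^sub>m n"
  shows "inertia_pos (T * A * mat_adjoint T) = inertia_pos A"
    and "inertia_neg (T * A * mat_adjoint T) = inertia_neg A"
proof -
  note Ac = hermitian_matsD(1)
  have pos: "inertia_pos (T * A * mat_adjoint T) = inertia_pos A" if A: "A \<in> hermitian_mats n" for A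
  proof (rule antisym[OF inertia_pos_congruence_le[OF A T]])
    have "S * (T * A * mat_adjoint T) * mat_adjoint S = (S * T) * A * (mat_adjoint T * mat_adjoint S)"
      using S T Ac[OF A] by (simp add: assoc_mult_mat[of _ n n _ n _ n] mult_carrier_mat[of _ n n _ n])
    also have "mat_adjoint T * mat_adjoint S = mat_adjoint (S * T)"
      by (rule mat_adjoint_mult[OF S T, symmetric])
    finally have "S * (T * A * mat_adjoint T) * mat_adjoint S = A"
      using ST Ac[OF A] by simp
    thus "inertia_pos A \<le> inertia_pos (T * A * mat_adjoint T)"
      using inertia_pos_congruence_le[OF hermitian_mats_congruence[OF A T] S] by simp
  qed
  show "inertia_pos (T * A * mat_adjoint T) = inertia_pos A" by (rule pos[OF A])
  note mA = hermitian_mats_uminus[OF A]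
  have "- (T * A * mat_adjoint T) = T * (- A) * mat_adjoint T"
    using T Ac[OF A] by (simp add: mult_carrier_mat[of _ n n _ n])
  thus "inertia_neg (T * A * mat_adjoint T) = inertia_neg A"
    unfolding inertia_neg_eq_inertia_pos_uminus[OF hermitian_mats_congruence[OF A T]]
      inertia_neg_eq_inertia_pos_uminus[OF A] using pos[OF mA] by simp
qed

lemma inertia_block_diag:
  assumes A: "A \<in> hermitian_mats m" and K: "K \<in> hermitian_mats n"
  shows "inertia_pos (four_block_mat A (0\<^sub>m m n) (0\<^sub>m n m) K) = inertia_pos A + inertia_pos K"
    and "inertia_neg (four_block_mat A (0\<^sub>m m n) (0\<^sub>m n m) K) = inertia_neg A + inertia_neg K"
proof -
  obtain U d where U: "U \<in> carrier_mat m m" "mat_adjoint U * U = 1\<^sub>m m" "U * mat_adjoint U = 1\<^sub>m m"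
    "A = U * mat_diag m (\<lambda>i. complex_of_real (d i)) * mat_adjoint U"
    using hermitian_spectral_decomposition[OF A] .
  obtain V e where V: "V \<in> carrier_mat n n" "mat_adjoint V * V = 1\<^sub>m n" "V * mat_adjoint V = 1\<^sub>m n"
    "K = V * mat_diag n (\<lambda>i. complex_of_real (e i)) * mat_adjoint V"
    using hermitian_spectral_decomposition[OF K] .
  let ?FB = "\<lambda>X Y. four_block_mat X (0\<^sub>m m n) (0\<^sub>m n m) Y :: complex mat"
  define W where "W = ?FB U V"
  define f where "f i = (if i < m then d i else e (i - m))" for i
  have W: "W \<in> carrier_mat (m + n) (m + n)" using U(1) V(1) by (simp add: W_def)
  have Wa: "mat_adjoint W = ?FB (mat_adjoint U) (mat_adjoint V)"
    unfolding W_def using U(1) V(1) by (subst mat_adjoint_four_block[of _ m m _ n _ n]) auto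
  have mult: "?FB X Y * ?FB X' Y' = ?FB (X * X') (Y * Y')"
    if "X \<in> carrier_mat m m" "X' \<in> carrier_mat m m" "Y \<in> carrier_mat n n" "Y' \<in> carrier_mat n n" for X X' Y Y'
    using that by (subst mult_four_block_mat[of _ m m _ n _ n _ _ m _ n]) auto
  have D: "mat_diag (m + n) (\<lambda>i. complex_of_real (f i)) =
      ?FB (mat_diag m (\<lambda>i. complex_of_real (d i))) (mat_diag n (\<lambda>i. complex_of_real (e i)))"
    by (rule eq_matI) (auto simp: mat_diag_def f_def)
  have W1: "mat_adjoint W * W = 1\<^sub>m (m + n)"
    unfolding Wa unfolding W_def using U(1,2) V(1,2) by (simp add: mult)
  have W2: "W * mat_adjoint W = 1\<^sub>m (m + n)"
    unfolding Wa unfolding W_def using U(1,3) V(1,3) by (simp add: mult)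
  have W3: "?FB A K = W * mat_diag (m + n) (\<lambda>i. complex_of_real (f i)) * mat_adjoint W"
    unfolding Wa D unfolding W_def U(4) V(4) using U(1) V(1)
    by (simp add: mult mult_carrier_mat[of _ m m _ m] mult_carrier_mat[of _ n n _ n])
  have count: "card {i. i < m + n \<and> P (f i)} = card {i. i < m \<and> P (d i)} + card {i. i < n \<and> P (e i)}"
    for P :: "real \<Rightarrow> bool"
  proof -
    have "{i. i < m + n \<and> P (f i)} = {i. i < m \<and> P (d i)} \<union> (+) m ` {i. i < n \<and> P (e i)}"
    proof (intro equalityI subsetI)
      fix i assume i: "i \<in> {i. i < m + n \<and> P (f i)}"
      show "i \<in> {i. i < m \<and> P (d i)} \<union> (+) m ` {i. i < n \<and> P (e i)}"
      proof (cases "i < m")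
        case True
        thus ?thesis using i by (simp add: f_def)
      next
        case False
        hence "i = m + (i - m)" "i - m < n" "P (e (i - m))" using i by (auto simp: f_def)
        thus ?thesis by blast
      qed
    qed (auto simp: f_def)
    moreover have "card ({i. i < m \<and> P (d i)} \<union> (+) m ` {i. i < n \<and> P (e i)}) =
        card {i. i < m \<and> P (d i)} + card ((+) m ` {i. i < n \<and> P (e i)})"
      by (rule card_Un_disjoint) auto
    ultimately show ?thesis by (simp add: card_image)
  qed
  show "inertia_pos (?FB A K) = inertia_pos A + inertia_pos K"
    "inertia_neg (?FB A K) = inertia_neg A + inertia_neg K"
    by (simp_all only: inertia_unitary_diag[OF W W1 W2 W3] inertia_unitary_diag[OF U]
        inertia_unitary_diag[OF V]
        count[of "\<lambda>x. 0 < x"] count[of "\<lambda>x. x < 0"])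
qed

text \<open>Haynsworth's additivity for the generalized Schur complement. The range inclusion says that
  \<open>K K\<^sup>\<dagger> N\<^sup>* = N\<^sup>*\<close>, which is what block elimination needs in place of invertibility of \<open>K\<close>.\<close>

theorem inertia_schur_complement:
  assumes A: "A \<in> hermitian_mats m" and N: "N \<in> carrier_mat m n" and K: "K \<in> hermitian_mats n"
    and range: "mat_range (mat_adjoint N) \<subseteq> mat_range K"
  defines "S \<equiv> A - N * mp_inverse K * mat_adjoint N"
  shows "inertia_pos (four_block_mat A N (mat_adjoint N) K) = inertia_pos S + inertia_pos K"
    and "inertia_neg (four_block_mat A N (mat_adjoint N) K) = inertia_neg S + inertia_neg K"
proof -
  note Ac = hermitian_matsD(1)[OF A] and Kc = hermitian_matsD[OF K]
  let ?G = "mp_inverse K"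
  note Gh = hermitian_mp_inverse(2)[OF K]
  note Gc = hermitian_matsD[OF Gh]
  have Na: "mat_adjoint N \<in> carrier_mat n m" using N by simp
  have Sh: "S \<in> hermitian_mats m"
    unfolding S_def by (intro hermitian_mats_minus A hermitian_mats_congruence[OF Gh N])
  note Sc = hermitian_matsD(1)[OF Sh]
  have NG: "N * ?G \<in> carrier_mat m n" and KG: "K * ?G \<in> carrier_mat n n" using N Gc Kc by auto
  have KGN: "K * ?G * mat_adjoint N = mat_adjoint N"
  proof (rule eq_matI)
    fix i j assume "i < dim_row (mat_adjoint N)" "j < dim_col (mat_adjoint N)"
    hence i: "i < n" and j: "j < m" using N by auto
    have cj: "col (mat_adjoint N) j \<in> carrier_vec n" using Na j by (intro col_carrier_vec) auto
    have "col (mat_adjoint N) j = mat_adjoint N *\<^sub>v unit_vec m j"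
      by (rule eq_vecI) (use Na j in auto)
    hence "col (mat_adjoint N) j \<in> mat_range (mat_adjoint N)"
      unfolding mat_range_iff[OF Na] using cj by auto
    hence "K *\<^sub>v (?G *\<^sub>v col (mat_adjoint N) j) = col (mat_adjoint N) j"
      using range by (intro mp_inverse_solves[OF K]) auto
    hence "(K * ?G) *\<^sub>v col (mat_adjoint N) j = col (mat_adjoint N) j"
      using assoc_mult_mat_vec[OF Kc(1) Gc(1) cj] by simp
    hence "col (K * ?G * mat_adjoint N) j = col (mat_adjoint N) j"
      using col_mult2[OF KG Na j] by simp
    thus "(K * ?G * mat_adjoint N) $$ (i, j) = mat_adjoint N $$ (i, j)"
      using i j KG Na by (metis index_col carrier_matD index_mult_mat(2,3))
  qed (use KG Na in auto)
  have NGa: "mat_adjoint (N * ?G) = ?G * mat_adjoint N"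
    using mat_adjoint_mult[OF N Gc(1)] Gc(2) by simp
  have NGK: "N * ?G * K = N"
  proof -
    have "mat_adjoint (N * ?G * K) = K * (?G * mat_adjoint N)"
      using mat_adjoint_mult[OF NG Kc(1)] Kc(2) NGa by simp
    also have "\<dots> = mat_adjoint N" using KGN assoc_mult_mat[OF Kc(1) Gc(1) Na] by simp
    finally show ?thesis by (metis mat_adjoint_adjoint)
  qed
  \<comment> \<open>Block elimination: \<open>T\<close> adds multiples of the lower block row to the upper one.\<close>
  define T where "T = four_block_mat (1\<^sub>m m) (N * ?G) (0\<^sub>m n m) (1\<^sub>m n)"
  define T' where "T' = four_block_mat (1\<^sub>m m) (- (N * ?G)) (0\<^sub>m n m) (1\<^sub>m n)"
  let ?D = "four_block_mat S (0\<^sub>m m n) (0\<^sub>m n m) K"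
  have T: "T \<in> carrier_mat (m + n) (m + n)" "T' \<in> carrier_mat (m + n) (m + n)"
    by (auto simp: T_def T'_def)
  have Ta: "mat_adjoint T = four_block_mat (1\<^sub>m m) (0\<^sub>m m n) (?G * mat_adjoint N) (1\<^sub>m n)"
    unfolding T_def using NG by (subst mat_adjoint_four_block[of _ m m _ n _ n]) (auto simp: NGa)
  have T'T: "T' * T = 1\<^sub>m (m + n)"
  proof -
    have "four_block_mat (1\<^sub>m m) (- H) (0\<^sub>m n m) (1\<^sub>m n) * four_block_mat (1\<^sub>m m) H (0\<^sub>m n m) (1\<^sub>m n) =
        1\<^sub>m (m + n)" if "H \<in> carrier_mat m n" for H :: "complex mat"
    proof -
      have "H + - H = 0\<^sub>m m n" by (rule eq_matI) (use that in auto)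
      thus ?thesis
        using that by (subst mult_four_block_mat[of _ m m _ n _ n _ _ m _ n]) auto
    qed
    from this[OF NG] show ?thesis unfolding T_def T'_def .
  qed
  have Dh: "?D \<in> hermitian_mats (m + n)"
    using Sh K by (auto simp: hermitian_mats_def mat_adjoint_four_block[of _ m m _ n _ n])
  have GN: "?G * mat_adjoint N \<in> carrier_mat n m" using Gc Na by auto
  have "T * ?D = four_block_mat S N (0\<^sub>m n m) K"
    unfolding T_def using NG Sc Kc(1) N
    by (subst mult_four_block_mat[of _ m m _ n _ n _ _ m _ n]) (auto simp: NGK)
  hence "T * ?D * mat_adjoint T = four_block_mat (S + N * (?G * mat_adjoint N)) N (K * (?G * mat_adjoint N)) K"
    unfolding Ta using GN Sc Kc(1) N
    by (simp, subst mult_four_block_mat[of _ m m _ n _ n _ _ m _ n]) auto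
  also have "S + N * (?G * mat_adjoint N) = A"
  proof -
    have "N * (?G * mat_adjoint N) = N * ?G * mat_adjoint N"
      using assoc_mult_mat[OF N Gc(1) Na] by simp
    thus ?thesis unfolding S_def using Ac NG Na by (intro eq_matI) auto
  qed
  also have "K * (?G * mat_adjoint N) = mat_adjoint N"
    using KGN assoc_mult_mat[OF Kc(1) Gc(1) Na] by simp
  finally have TDT: "T * ?D * mat_adjoint T = four_block_mat A N (mat_adjoint N) K" .
  show "inertia_pos (four_block_mat A N (mat_adjoint N) K) = inertia_pos S + inertia_pos K"
    "inertia_neg (four_block_mat A N (mat_adjoint N) K) = inertia_neg S + inertia_neg K"
    using sylvester_law_of_inertia[OF Dh T T'T] inertia_block_diag[OF Sh K] by (simp_all add: TDT)
qed

section \<open>Block rows and columns with a zero block\<close>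

lemma append_rows_zero_mult_vec:
  fixes C :: "complex mat"
  assumes "C \<in> carrier_mat n k" "w \<in> carrier_vec k"
  shows "(0\<^sub>m m k @\<^sub>r C) *\<^sub>v w = 0\<^sub>v m @\<^sub>v (C *\<^sub>v w)"
  using mat_mult_append[of "0\<^sub>m m k" m k C n w] assms by (simp add: zero_mat_mult_vec)

lemma append_cols_zero_carrier:
  assumes "C \<in> carrier_mat k n"
  shows "0\<^sub>m k m @\<^sub>c C \<in> carrier_mat k (m + n)"
  using assms by (auto simp: append_cols_def)

lemma mat_adjoint_append_rows_zero:
  assumes "C \<in> carrier_mat n k"
  shows "mat_adjoint (0\<^sub>m m k @\<^sub>r C) = 0\<^sub>m k m @\<^sub>c mat_adjoint C"
  by (rule eq_matI) (use assms in \<open>auto simp: append_rows_def append_cols_def\<close>)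

lemma mat_adjoint_append_cols_zero:
  assumes "C \<in> carrier_mat k n"
  shows "mat_adjoint (0\<^sub>m k m @\<^sub>c C) = 0\<^sub>m m k @\<^sub>r mat_adjoint C"
  using mat_adjoint_append_rows_zero[of "mat_adjoint C" n k m] assms
  by (metis mat_adjoint_adjoint mat_adjoint_carrier)

lemma append_cols_zero_mult_vec:
  assumes "C \<in> carrier_mat k n" "u \<in> carrier_vec m" "x \<in> carrier_vec n"
  shows "(0\<^sub>m k m @\<^sub>c C) *\<^sub>v (u @\<^sub>v x) = C *\<^sub>v x"
proof -
  have "(0\<^sub>m k m @\<^sub>c C) *\<^sub>v (u @\<^sub>v x) =
      (0\<^sub>m k m *\<^sub>v u + C *\<^sub>v x) @\<^sub>v (0\<^sub>m 0 m *\<^sub>v u + 0\<^sub>m 0 n *\<^sub>v x)"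
    unfolding append_cols_def using assms
    by (subst four_block_mat_mult_vec[of _ k m _ n _ 0]) auto
  also have "\<dots> = C *\<^sub>v x"
    by (rule eq_vecI) (use assms in auto)
  finally show ?thesis .
qed

lemma append_cols_zero_factor:
  assumes "C \<in> carrier_mat k n"
  shows "0\<^sub>m k m @\<^sub>c C = C * (0\<^sub>m n m @\<^sub>c 1\<^sub>m n)"
proof (rule eq_matI)
  fix i j assume "i < dim_row (C * (0\<^sub>m n m @\<^sub>c 1\<^sub>m n))" "j < dim_col (C * (0\<^sub>m n m @\<^sub>c 1\<^sub>m n))"
  hence ij: "i < k" "j < m + n" using assms by (auto simp: append_cols_def)
  have "(C * (0\<^sub>m n m @\<^sub>c 1\<^sub>m n)) $$ (i, j) =
      (\<Sum>l<n. C $$ (i,l) * (if j < m then 0 else if l = j - m then 1 else 0))"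
    using ij assms by (auto simp: append_cols_def scalar_prod_def atLeast0LessThan intro!: sum.cong)
  also have "\<dots> = (\<Sum>l<n. if l = j - m then (if j < m then 0 else C $$ (i,l)) else 0)"
    by (rule sum.cong) auto
  also have "\<dots> = (0\<^sub>m k m @\<^sub>c C) $$ (i, j)"
    using ij assms by (auto simp: append_cols_def)
  finally show "(0\<^sub>m k m @\<^sub>c C) $$ (i, j) = (C * (0\<^sub>m n m @\<^sub>c 1\<^sub>m n)) $$ (i, j)" by simp
qed (use assms in \<open>auto simp: append_cols_def\<close>)

text \<open>Only the lower right block of the Moore-Penrose inverse of the bordered matrix enters the formulas:
  it is the maximizer, and the maximal value depends on it through \<open>C X C\<^sup>*\<close>.\<close>

lemma append_cols_sandwich:
  assumes C: "C \<in> carrier_mat k n" and G: "G \<in> carrier_mat (m + n) (m + n)"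
  shows "(0\<^sub>m k m @\<^sub>c C) * G * (0\<^sub>m m k @\<^sub>r mat_adjoint C) =
    C * ((0\<^sub>m n m @\<^sub>c 1\<^sub>m n) * G * (0\<^sub>m m n @\<^sub>r 1\<^sub>m n)) * mat_adjoint C"
proof -
  let ?E = "0\<^sub>m n m @\<^sub>c 1\<^sub>m n :: complex mat"
  have E: "?E \<in> carrier_mat n (m + n)" by (rule append_cols_zero_carrier) simp
  have Ea: "mat_adjoint ?E = 0\<^sub>m m n @\<^sub>r 1\<^sub>m n"
    using mat_adjoint_append_cols_zero[of "1\<^sub>m n" n n m] by simp
  have "0\<^sub>m m k @\<^sub>r mat_adjoint C = mat_adjoint (0\<^sub>m k m @\<^sub>c C)"
    by (rule mat_adjoint_append_cols_zero[OF C, symmetric])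
  also have "\<dots> = mat_adjoint ?E * mat_adjoint C"
    unfolding append_cols_zero_factor[OF C] by (rule mat_adjoint_mult[OF C E])
  finally have 1: "0\<^sub>m m k @\<^sub>r mat_adjoint C = mat_adjoint ?E * mat_adjoint C" .
  have a: "C * ?E * G = C * (?E * G)" by (rule assoc_mult_mat[OF C E G])
  have b: "?E * G \<in> carrier_mat n (m + n)" using E G by simp
  have c: "mat_adjoint ?E \<in> carrier_mat (m + n) n" "mat_adjoint C \<in> carrier_mat n k"
    using E C by simp_all
  have "C * (?E * G) * (mat_adjoint ?E * mat_adjoint C) = C * (?E * G * (mat_adjoint ?E * mat_adjoint C))"
    by (rule assoc_mult_mat[OF C b mult_carrier_mat[OF c]])
  also have "?E * G * (mat_adjoint ?E * mat_adjoint C) = ?E * G * mat_adjoint ?E * mat_adjoint C"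
    by (rule assoc_mult_mat[OF b c, symmetric])
  also have "C * \<dots> = C * (?E * G * mat_adjoint ?E) * mat_adjoint C"
    by (rule assoc_mult_mat[OF C _ c(2), symmetric]) (use b c in simp)
  finally show ?thesis
    unfolding append_cols_zero_factor[OF C] 1 a Ea .
qed

text \<open>Grouping the last two block rows and columns exhibits the bordered matrix as the lower right corner,
  the position from which its Schur complement is taken.\<close>

lemma bordered_blocks_regroup:
  fixes A1 A2 B1 B2 :: "complex mat"
  assumes "A1 \<in> carrier_mat m1 m1" "A2 \<in> carrier_mat m2 m2" "B1 \<in> carrier_mat m1 n" "B2 \<in> carrier_mat m2 n"
  shows "(A1 @\<^sub>c 0\<^sub>m m1 m2 @\<^sub>c B1) @\<^sub>r (0\<^sub>m m2 m1 @\<^sub>c (- A2) @\<^sub>c B2) @\<^sub>r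
      (mat_adjoint B1 @\<^sub>c mat_adjoint B2 @\<^sub>c 0\<^sub>m n n) =
    four_block_mat A1 (0\<^sub>m m1 m2 @\<^sub>c B1) (mat_adjoint (0\<^sub>m m1 m2 @\<^sub>c B1))
      (four_block_mat (- A2) B2 (mat_adjoint B2) (0\<^sub>m n n))"
  by (rule eq_matI) (use assms in \<open>auto simp: append_rows_def append_cols_def\<close>)

section \<open>The bordered matrix of the constraint\<close>

lemma bordered_hermitian:
  assumes A: "A \<in> hermitian_mats m" and B: "B \<in> carrier_mat m n"
  shows "four_block_mat (- A) B (mat_adjoint B) (0\<^sub>m n n) \<in> hermitian_mats (m + n)"
  using hermitian_matsD[OF hermitian_mats_uminus[OF A]] B
  by (auto simp: hermitian_mats_def mat_adjoint_four_block[of _ m m _ n _ n])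

lemma bordered_mult_vec:
  assumes A: "A \<in> carrier_mat m m" and B: "B \<in> carrier_mat m n"
    and u: "u \<in> carrier_vec m" and x: "x \<in> carrier_vec n"
  shows "four_block_mat (- A) B (mat_adjoint B) (0\<^sub>m n n) *\<^sub>v (u @\<^sub>v x) =
    (B *\<^sub>v x - A *\<^sub>v u) @\<^sub>v (mat_adjoint B *\<^sub>v u)"
proof -
  have "(- A) *\<^sub>v u + B *\<^sub>v x = B *\<^sub>v x - A *\<^sub>v u"
    by (rule eq_vecI) (use A B u x in auto)
  thus ?thesis
    using A B u x by (subst four_block_mat_mult_vec[of _ m m _ n _ n]) (auto intro!: right_zero_vec)
qed

context
  fixes A B K :: "complex mat" and m n :: nat
  assumes A: "A \<in> hermitian_mats m" and B: "B \<in> carrier_mat m n"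
    and K: "K = four_block_mat (- A) B (mat_adjoint B) (0\<^sub>m n n)"
begin

text \<open>Here \<open>u\<close> is the upper part of the solution of \<open>K (u, x) = (0, C\<^sup>* w)\<close> that the Moore-Penrose inverse
  selects. Its lower part \<open>x\<close> enters the properties needed later only through \<open>B x = A u\<close>, which
  makes \<open>A u\<close> orthogonal to the kernel of \<open>B\<^sup>*\<close> and evaluates the quadratic form of the candidate.\<close>

lemma bordered_solution:
  assumes C: "C \<in> carrier_mat k n" and range: "mat_range (0\<^sub>m m k @\<^sub>r mat_adjoint C) \<subseteq> mat_range K"
    and w: "w \<in> carrier_vec k"
  obtains u where "u \<in> carrier_vec m" "mat_adjoint B *\<^sub>v u = mat_adjoint C *\<^sub>v w"
    "\<And>p. p \<in> carrier_vec m \<Longrightarrow> mat_adjoint B *\<^sub>v p = 0\<^sub>v n \<Longrightarrow> (A *\<^sub>v u) \<bullet>c p = 0"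
    "(((0\<^sub>m k m @\<^sub>c C) * mp_inverse K * (0\<^sub>m m k @\<^sub>r mat_adjoint C)) *\<^sub>v w) \<bullet>c w = (A *\<^sub>v u) \<bullet>c u"
proof -
  note Ac = hermitian_matsD(1)[OF A]
  have Kh: "K \<in> hermitian_mats (m + n)" unfolding K by (rule bordered_hermitian[OF A B])
  note G = hermitian_matsD(1)[OF hermitian_mp_inverse(2)[OF Kh]]
  have R: "0\<^sub>m m k @\<^sub>r mat_adjoint C \<in> carrier_mat (m + n) k"
    using C by (intro carrier_append_rows) auto
  define b where "b = 0\<^sub>v m @\<^sub>v (mat_adjoint C *\<^sub>v w)"
  have Cw: "mat_adjoint C *\<^sub>v w \<in> carrier_vec n" 
    using C by (intro mult_mat_vec_carrier[of _ n k] w) simp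
  have b: "b \<in> carrier_vec (m + n)" unfolding b_def using Cw by (intro append_carrier_vec) auto
  have bR: "(0\<^sub>m m k @\<^sub>r mat_adjoint C) *\<^sub>v w = b"
    unfolding b_def using C by (intro append_rows_zero_mult_vec w) simp
  hence "b \<in> mat_range (0\<^sub>m m k @\<^sub>r mat_adjoint C)"
    unfolding mat_range_iff[OF R] using b w by auto
  hence sol: "K *\<^sub>v (mp_inverse K *\<^sub>v b) = b"
    using range by (intro mp_inverse_solves[OF Kh]) auto
  define z where "z = mp_inverse K *\<^sub>v b"
  define u x where "u = vec_first z m" and "x = vec_last z n"
  have z: "z \<in> carrier_vec (m + n)" using G b by (simp add: z_def)
  have u: "u \<in> carrier_vec m" and x: "x \<in> carrier_vec n" by (auto simp: u_def x_def)
  have zux: "z = u @\<^sub>v x" using z by (simp add: u_def x_def)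
  have "K *\<^sub>v (u @\<^sub>v x) = b" using sol by (simp only: z_def[symmetric] zux)
  hence "(B *\<^sub>v x - A *\<^sub>v u) @\<^sub>v (mat_adjoint B *\<^sub>v u) = 0\<^sub>v m @\<^sub>v (mat_adjoint C *\<^sub>v w)"
    unfolding K bordered_mult_vec[OF Ac B u x] b_def .
  moreover have "B *\<^sub>v x - A *\<^sub>v u \<in> carrier_vec m" using B Ac x u by simp
  ultimately have 1: "B *\<^sub>v x = A *\<^sub>v u" "mat_adjoint B *\<^sub>v u = mat_adjoint C *\<^sub>v w"
    using Ac B x u by (auto simp: append_vec_eq[of _ m] minus_vec_eq_zero_iff[of _ m])
  have Bx: "(A *\<^sub>v u) \<bullet>c p = x \<bullet>c (mat_adjoint B *\<^sub>v p)" if "p \<in> carrier_vec m" for p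
    using mult_mat_vec_cscalar_adjoint[OF B x that] 1(1) by simp
  have "((0\<^sub>m k m @\<^sub>c C) * mp_inverse K * (0\<^sub>m m k @\<^sub>r mat_adjoint C)) *\<^sub>v w = (0\<^sub>m k m @\<^sub>c C) *\<^sub>v z"
    using append_cols_zero_carrier[OF C, of m] G R w b
    by (simp add: assoc_mult_mat_vec[of _ k "m + n" _ k] assoc_mult_mat_vec[of _ k "m + n" _ "m + n"]
        bR z_def)
  also have "\<dots> = C *\<^sub>v x"
    unfolding zux by (rule append_cols_zero_mult_vec[OF C u x])
  finally have "(((0\<^sub>m k m @\<^sub>c C) * mp_inverse K * (0\<^sub>m m k @\<^sub>r mat_adjoint C)) *\<^sub>v w) \<bullet>c w =
      x \<bullet>c (mat_adjoint C *\<^sub>v w)"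
    using mult_mat_vec_cscalar_adjoint[OF C x w] by simp
  also have "\<dots> = (A *\<^sub>v u) \<bullet>c u" using Bx[OF u] 1(2) by simp
  finally have 2: "(((0\<^sub>m k m @\<^sub>c C) * mp_inverse K * (0\<^sub>m m k @\<^sub>r mat_adjoint C)) *\<^sub>v w) \<bullet>c w = (A *\<^sub>v u) \<bullet>c u" .
  show ?thesis
    by (rule that[OF u 1(2) _ 2]) (use Bx x in simp)
qed

text \<open>Under feasibility the kernel of \<open>K\<close> contains \<open>(u, x)\<close> only if \<open>B x = 0\<close>, and it contains every such
  \<open>(0, x)\<close>. Orthogonality of \<open>(0, C\<^sup>* w)\<close> to it for all \<open>w\<close> then means that \<open>C\<close> vanishes on the kernel
  of \<open>B\<close>.\<close>

lemma bordered_range_iff: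
  assumes X: "X \<in> hermitian_mats n" "B * X * mat_adjoint B \<succeq> A" and C: "C \<in> carrier_mat k n"
  shows "mat_range (0\<^sub>m m k @\<^sub>r mat_adjoint C) \<subseteq> mat_range K \<longleftrightarrow>
    (\<forall>x \<in> carrier_vec n. B *\<^sub>v x = 0\<^sub>v m \<longrightarrow> C *\<^sub>v x = 0\<^sub>v k)"
proof -
  note Ac = hermitian_matsD[OF A] and Xc = hermitian_matsD(1)[OF X(1)]
  have Kh: "K \<in> hermitian_mats (m + n)" unfolding K by (rule bordered_hermitian[OF A B])
  have R: "0\<^sub>m m k @\<^sub>r mat_adjoint C \<in> carrier_mat (m + n) k"
    using C by (intro carrier_append_rows) auto
  have Rw: "(0\<^sub>m m k @\<^sub>r mat_adjoint C) *\<^sub>v w = 0\<^sub>v m @\<^sub>v (mat_adjoint C *\<^sub>v w)" if "w \<in> carrier_vec k" for w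
    using C that by (intro append_rows_zero_mult_vec) simp
  have Cw: "mat_adjoint C *\<^sub>v w \<in> carrier_vec n" if "w \<in> carrier_vec k" for w
    using C that by (intro mult_mat_vec_carrier[of _ n k]) simp_all
  have pair: "(0\<^sub>v m @\<^sub>v (mat_adjoint C *\<^sub>v w)) \<bullet>c (u @\<^sub>v x) = w \<bullet>c (C *\<^sub>v x)"
    if w: "w \<in> carrier_vec k" and u: "u \<in> carrier_vec m" and x: "x \<in> carrier_vec n" for w u x
  proof -
    have "conjugate (u @\<^sub>v x) = conjugate u @\<^sub>v conjugate x"
      by (rule eq_vecI) (use u x in auto)
    hence "(0\<^sub>v m @\<^sub>v (mat_adjoint C *\<^sub>v w)) \<bullet>c (u @\<^sub>v x) = (mat_adjoint C *\<^sub>v w) \<bullet>c x"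
      using u x Cw[OF w] by (simp add: scalar_prod_append[of _ m _ n])
    also have "\<dots> = w \<bullet>c (C *\<^sub>v x)"
      using mult_mat_vec_cscalar_adjoint[of "mat_adjoint C" n k w x] C w x by simp
    finally show ?thesis .
  qed
  have psd: "positive_semidefinite (B * X * mat_adjoint B - A)"
    using X(2) by (simp add: loewner_ge_def)
  \<comment> \<open>This is the step that needs a feasible point: the slack matrix turns the vanishing of
    \<open>u\<^sup>* A u\<close> into \<open>A u = 0\<close>.\<close>
  have kernel: "K *\<^sub>v (u @\<^sub>v x) = 0\<^sub>v (m + n) \<Longrightarrow> B *\<^sub>v x = 0\<^sub>v m"
    if u: "u \<in> carrier_vec m" and x: "x \<in> carrier_vec n" for u x
  proof -
    assume "K *\<^sub>v (u @\<^sub>v x) = 0\<^sub>v (m + n)"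
    also have "0\<^sub>v (m + n) = 0\<^sub>v m @\<^sub>v 0\<^sub>v n" by (rule eq_vecI) auto
    finally have "(B *\<^sub>v x - A *\<^sub>v u) @\<^sub>v (mat_adjoint B *\<^sub>v u) = 0\<^sub>v m @\<^sub>v 0\<^sub>v n"
      unfolding K bordered_mult_vec[OF Ac(1) B u x] .
    moreover have "B *\<^sub>v x - A *\<^sub>v u \<in> carrier_vec m" using B Ac x u by simp
    ultimately have 1: "B *\<^sub>v x = A *\<^sub>v u" "mat_adjoint B *\<^sub>v u = 0\<^sub>v n"
      using Ac B x u by (auto simp: append_vec_eq[of _ m] minus_vec_eq_zero_iff[of _ m])
    let ?Y = "B * X * mat_adjoint B - A"
    have BXB: "B * X * mat_adjoint B \<in> carrier_mat m m"
      using hermitian_matsD(1)[OF hermitian_mats_congruence[OF X(1) B]] .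
    have "(B * X * mat_adjoint B) *\<^sub>v u = (B * X) *\<^sub>v (mat_adjoint B *\<^sub>v u)"
      using B Xc u by (intro assoc_mult_mat_vec[of _ m n]) auto
    also have "\<dots> = 0\<^sub>v m" unfolding 1(2) using B Xc by (intro mult_mat_zero_vec) auto
    finally have Yu: "?Y *\<^sub>v u = - (A *\<^sub>v u)"
      using BXB Ac u by (simp add: minus_mult_distrib_mat_vec[of _ m m]) 
    have "(A *\<^sub>v u) \<bullet>c u = 0"
      using mult_mat_vec_cscalar_adjoint[OF B x u] 1 x by simp
    hence "(?Y *\<^sub>v u) \<bullet>c u = 0" unfolding Yu using Ac u by simp
    hence "?Y *\<^sub>v u = 0\<^sub>v m"
      by (rule psd_quadratic_form_zero[OF psd minus_carrier_mat[OF Ac(1)] u])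
    hence "- (- (A *\<^sub>v u)) = - 0\<^sub>v m" unfolding Yu by simp
    thus "B *\<^sub>v x = 0\<^sub>v m" using 1(1) by simp
  qed
  show ?thesis
  proof
    assume range: "mat_range (0\<^sub>m m k @\<^sub>r mat_adjoint C) \<subseteq> mat_range K"
    show "\<forall>x \<in> carrier_vec n. B *\<^sub>v x = 0\<^sub>v m \<longrightarrow> C *\<^sub>v x = 0\<^sub>v k"
    proof (intro ballI impI)
      fix x assume x: "x \<in> carrier_vec n" "B *\<^sub>v x = 0\<^sub>v m"
      \<comment> \<open>Test the range condition on the vector \<open>C x\<close> itself against the kernel vector \<open>(0, x)\<close>.\<close>
      let ?w = "C *\<^sub>v x"
      have w: "?w \<in> carrier_vec k" using C x by simp
      have "0\<^sub>v m @\<^sub>v (mat_adjoint C *\<^sub>v ?w) \<in> mat_range (0\<^sub>m m k @\<^sub>r mat_adjoint C)"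
        unfolding mat_range_iff[OF R] using Rw[OF w] w Cw[OF w] by (auto intro!: append_carrier_vec)
      hence "0\<^sub>v m @\<^sub>v (mat_adjoint C *\<^sub>v ?w) \<in> mat_range K" using range by blast
      moreover have "K *\<^sub>v (0\<^sub>v m @\<^sub>v x) = 0\<^sub>v (m + n)"
        unfolding K bordered_mult_vec[OF Ac(1) B zero_carrier_vec x(1)] x(2)
          mult_mat_zero_vec[OF Ac(1)] mult_mat_zero_vec[OF mat_adjoint_carrier[THEN iffD2, OF B]]
        by (rule eq_vecI) auto
      moreover have "0\<^sub>v m @\<^sub>v x \<in> carrier_vec (m + n)"
        by (rule append_carrier_vec[OF zero_carrier_vec x(1)])
      ultimately have "(0\<^sub>v m @\<^sub>v (mat_adjoint C *\<^sub>v ?w)) \<bullet>c (0\<^sub>v m @\<^sub>v x) = 0"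
        using hermitian_range_iff_orthogonal_kernel[OF Kh append_carrier_vec[OF zero_carrier_vec Cw[OF w]]]
        by blast
      hence "?w \<bullet>c ?w = 0" using pair[OF w zero_carrier_vec x(1)] by simp
      thus "C *\<^sub>v x = 0\<^sub>v k" using w by simp
    qed
  next
    assume ker: "\<forall>x \<in> carrier_vec n. B *\<^sub>v x = 0\<^sub>v m \<longrightarrow> C *\<^sub>v x = 0\<^sub>v k"
    show "mat_range (0\<^sub>m m k @\<^sub>r mat_adjoint C) \<subseteq> mat_range K"
    proof
      fix b assume "b \<in> mat_range (0\<^sub>m m k @\<^sub>r mat_adjoint C)"
      then obtain w where w: "w \<in> carrier_vec k" and b: "b \<in> carrier_vec (m + n)"
        "b = 0\<^sub>v m @\<^sub>v (mat_adjoint C *\<^sub>v w)"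
        by (auto simp: mat_range_iff[OF R] Rw)
      show "b \<in> mat_range K"
        unfolding hermitian_range_iff_orthogonal_kernel[OF Kh b(1)]
      proof (intro ballI impI)
        fix z assume z: "z \<in> carrier_vec (m + n)" "K *\<^sub>v z = 0\<^sub>v (m + n)"
        define u x where "u = vec_first z m" and "x = vec_last z n"
        have u: "u \<in> carrier_vec m" and x: "x \<in> carrier_vec n" by (auto simp: u_def x_def)
        have zux: "z = u @\<^sub>v x" using z by (simp add: u_def x_def)
        have "C *\<^sub>v x = 0\<^sub>v k" using ker x kernel[OF u x] z(2) zux by simp
        thus "b \<bullet>c z = 0" unfolding b(2) zux pair[OF w u x] using w by simp
      qed
    qed
  qed
qed

text \<open>Because \<open>B\<^sup>* u = C\<^sup>* w\<close>, the form of \<open>C X C\<^sup>*\<close> at \<open>w\<close> is the form of \<open>B X B\<^sup>*\<close> at \<open>u\<close>, which the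
  constraint bounds below by \<open>u\<^sup>* A u\<close>. This is the value of the right-hand side at \<open>w\<close>.\<close>

lemma bordered_lower_bound:
  assumes C: "C \<in> carrier_mat k n" and range: "mat_range (0\<^sub>m m k @\<^sub>r mat_adjoint C) \<subseteq> mat_range K"
    and X: "X \<in> hermitian_mats n" "B * X * mat_adjoint B \<succeq> A"
  shows "C * X * mat_adjoint C \<succeq> (0\<^sub>m k m @\<^sub>c C) * mp_inverse K * (0\<^sub>m m k @\<^sub>r mat_adjoint C)"
proof -
  have Kh: "K \<in> hermitian_mats (m + n)" unfolding K by (rule bordered_hermitian[OF A B])
  note Gh = hermitian_mp_inverse(2)[OF Kh]
  have CCh: "(0\<^sub>m k m @\<^sub>c C) * mp_inverse K * (0\<^sub>m m k @\<^sub>r mat_adjoint C) \<in> hermitian_mats k"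
    using hermitian_mats_congruence[OF Gh append_cols_zero_carrier[OF C, of m]]
      mat_adjoint_append_cols_zero[OF C, of m] by simp
  show ?thesis
    unfolding loewner_ge_iff[OF hermitian_mats_congruence[OF X(1) C] CCh]
  proof
    fix w :: "complex vec" assume w: "w \<in> carrier_vec k"
    obtain u where u: "u \<in> carrier_vec m" "mat_adjoint B *\<^sub>v u = mat_adjoint C *\<^sub>v w"
      "(((0\<^sub>m k m @\<^sub>c C) * mp_inverse K * (0\<^sub>m m k @\<^sub>r mat_adjoint C)) *\<^sub>v w) \<bullet>c w = (A *\<^sub>v u) \<bullet>c u"
      using bordered_solution[OF C range w] by metis
    have "(A *\<^sub>v u) \<bullet>c u \<le> ((B * X * mat_adjoint B) *\<^sub>v u) \<bullet>c u"
      using X(2) u(1) loewner_ge_iff[OF hermitian_mats_congruence[OF X(1) B] A] by blast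
    also have "\<dots> = ((C * X * mat_adjoint C) *\<^sub>v w) \<bullet>c w"
      using quadratic_form_congruence[OF hermitian_matsD(1)[OF X(1)] B u(1)]
        quadratic_form_congruence[OF hermitian_matsD(1)[OF X(1)] C w] u(2) by simp
    finally show "(((0\<^sub>m k m @\<^sub>c C) * mp_inverse K * (0\<^sub>m m k @\<^sub>r mat_adjoint C)) *\<^sub>v w) \<bullet>c w \<le>
        ((C * X * mat_adjoint C) *\<^sub>v w) \<bullet>c w"
      unfolding u(3) .
  qed
qed

text \<open>For \<open>C = B\<close> the vectors \<open>w\<close> and \<open>u\<close> differ by some \<open>p\<close> in the kernel of \<open>B\<^sup>*\<close>. The mixed terms of
  \<open>w\<^sup>* A w\<close> vanish since \<open>A u\<close> is orthogonal to this kernel, and \<open>p\<^sup>* A p \<le> 0\<close> since the form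
  of \<open>B X B\<^sup>*\<close> vanishes at \<open>p\<close> for every feasible \<open>X\<close>.\<close>

lemma bordered_solution_feasible:
  assumes X: "X \<in> hermitian_mats n" "B * X * mat_adjoint B \<succeq> A"
  shows "(0\<^sub>m m m @\<^sub>c B) * mp_inverse K * (0\<^sub>m m m @\<^sub>r mat_adjoint B) \<succeq> A"
proof -
  have Kh: "K \<in> hermitian_mats (m + n)" unfolding K by (rule bordered_hermitian[OF A B])
  note Gh = hermitian_mp_inverse(2)[OF Kh]
  note Ac = hermitian_matsD[OF A]
  have BBh: "(0\<^sub>m m m @\<^sub>c B) * mp_inverse K * (0\<^sub>m m m @\<^sub>r mat_adjoint B) \<in> hermitian_mats m"
    using hermitian_mats_congruence[OF Gh append_cols_zero_carrier[OF B, of m]]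
      mat_adjoint_append_cols_zero[OF B, of m] by simp
  \<comment> \<open>The range condition for the constraint matrix itself is the trivial kernel inclusion.\<close>
  have range: "mat_range (0\<^sub>m m m @\<^sub>r mat_adjoint B) \<subseteq> mat_range K"
    using bordered_range_iff[OF X B] by simp
  show ?thesis
    unfolding loewner_ge_iff[OF BBh A]
  proof
    fix w :: "complex vec" assume w: "w \<in> carrier_vec m"
    obtain u where u: "u \<in> carrier_vec m" "mat_adjoint B *\<^sub>v u = mat_adjoint B *\<^sub>v w"
      "\<And>p. p \<in> carrier_vec m \<Longrightarrow> mat_adjoint B *\<^sub>v p = 0\<^sub>v n \<Longrightarrow> (A *\<^sub>v u) \<bullet>c p = 0"
      "(((0\<^sub>m m m @\<^sub>c B) * mp_inverse K * (0\<^sub>m m m @\<^sub>r mat_adjoint B)) *\<^sub>v w) \<bullet>c w = (A *\<^sub>v u) \<bullet>c u"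
      using bordered_solution[OF B range w] by metis
    define p where "p = w - u"
    have p: "p \<in> carrier_vec m" using w u(1) by (simp add: p_def)
    have wp: "w = u + p" by (rule eq_vecI) (use w u(1) in \<open>auto simp: p_def\<close>)
    have Ba: "mat_adjoint B \<in> carrier_mat n m" using B by simp
    have Bp: "mat_adjoint B *\<^sub>v p = 0\<^sub>v n"
      unfolding p_def mult_minus_distrib_mat_vec[OF Ba w u(1)] u(2)
      using mult_mat_vec_carrier[OF Ba w] by simp
    have Aup: "(A *\<^sub>v u) \<bullet>c p = 0" by (rule u(3)[OF p Bp])
    have Au: "A *\<^sub>v u \<in> carrier_vec m" "A *\<^sub>v p \<in> carrier_vec m" using Ac(1) u(1) p by auto
    have "(A *\<^sub>v p) \<bullet>c u = p \<bullet>c (A *\<^sub>v u)"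
      using mult_mat_vec_cscalar_adjoint[OF Ac(1) p u(1)] Ac(2) by simp
    also have "\<dots> = conjugate ((A *\<^sub>v u) \<bullet>c p)"
    proof -
      have "conjugate ((A *\<^sub>v u) \<bullet>c p) = conjugate (A *\<^sub>v u) \<bullet> p"
        using conjugate_sprod_vec[OF Au(1) carrier_vec_conjugate[OF p]] by simp
      also have "\<dots> = p \<bullet>c (A *\<^sub>v u)"
        by (rule comm_scalar_prod[OF carrier_vec_conjugate[OF Au(1)] p])
      finally show ?thesis by simp
    qed
    finally have Apu: "(A *\<^sub>v p) \<bullet>c u = 0" using Aup by simp
    have "(A *\<^sub>v p) \<bullet>c p \<le> ((B * X * mat_adjoint B) *\<^sub>v p) \<bullet>c p"
      using X(2) p loewner_ge_iff[OF hermitian_mats_congruence[OF X(1) B] A] by blast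
    also have "\<dots> = 0"
      using quadratic_form_congruence[OF hermitian_matsD(1)[OF X(1)] B p] Bp hermitian_matsD(1)[OF X(1)]
      by (simp add: mult_mat_zero_vec)
    finally have App: "(A *\<^sub>v p) \<bullet>c p \<le> 0" .
    have "(A *\<^sub>v w) \<bullet>c w = (A *\<^sub>v u) \<bullet>c u + (A *\<^sub>v u) \<bullet>c p + ((A *\<^sub>v p) \<bullet>c u + (A *\<^sub>v p) \<bullet>c p)"
      unfolding wp using Ac(1) u(1) p Au
      by (simp add: mult_add_distrib_mat_vec[of _ m m] conjugate_add_vec[of _ m]
          add_scalar_prod_distrib[of _ m] scalar_prod_add_distrib[of _ m] algebra_simps)
    also have "\<dots> \<le> (A *\<^sub>v u) \<bullet>c u" using Aup Apu App by simp
    finally show "(A *\<^sub>v w) \<bullet>c w \<le>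
      (((0\<^sub>m m m @\<^sub>c B) * mp_inverse K * (0\<^sub>m m m @\<^sub>r mat_adjoint B)) *\<^sub>v w) \<bullet>c w"
      unfolding u(4) .
  qed
qed

end

section \<open>The maximum in the Loewner order\<close>

text \<open>Subtracting \<open>x x\<^sup>*\<close> with \<open>B x = 0\<close> does not change \<open>B X0 B\<^sup>*\<close>, so it preserves feasibility; a least
  value of \<open>C X C\<^sup>*\<close> must then be insensitive to it as well.\<close>

lemma least_imp_kernel_le:
  assumes A: "A \<in> hermitian_mats m" and B: "B \<in> carrier_mat m n" and C: "C \<in> carrier_mat k n"
    and X0: "X0 \<in> hermitian_mats n" "B * X0 * mat_adjoint B \<succeq> A"
    and least: "\<And>X. X \<in> hermitian_mats n \<Longrightarrow> B * X * mat_adjoint B \<succeq> A \<Longrightarrow>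
      C * X * mat_adjoint C \<succeq> C * X0 * mat_adjoint C"
    and x: "x \<in> carrier_vec n" "B *\<^sub>v x = 0\<^sub>v m"
  shows "C *\<^sub>v x = 0\<^sub>v k"
proof -
  define R where "R = mat n n (\<lambda>(i,j). x $ i * cnj (x $ j))"
  define X where "X = X0 - R"
  have Rh: "R \<in> hermitian_mats n" unfolding R_def by (rule outer_product_hermitian)
  have Xh: "X \<in> hermitian_mats n" unfolding X_def by (rule hermitian_mats_minus[OF X0(1) Rh])
  note Rc = hermitian_matsD(1)[OF Rh] and X0c = hermitian_matsD(1)[OF X0(1)] and Xc = hermitian_matsD(1)[OF Xh]
  have form: "((D * X * mat_adjoint D) *\<^sub>v v) \<bullet>c v =
      ((D * X0 * mat_adjoint D) *\<^sub>v v) \<bullet>c v - (v \<bullet>c (D *\<^sub>v x)) * ((D *\<^sub>v x) \<bullet>c v)"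
    if D: "D \<in> carrier_mat l n" and v: "v \<in> carrier_vec l" for D l v
  proof -
    let ?y = "mat_adjoint D *\<^sub>v v"
    have Da: "mat_adjoint D \<in> carrier_mat n l" using D by simp
    have y: "?y \<in> carrier_vec n" by (rule mult_mat_vec_carrier[OF Da v])
    have "(X *\<^sub>v ?y) \<bullet>c ?y = (X0 *\<^sub>v ?y) \<bullet>c ?y - (R *\<^sub>v ?y) \<bullet>c ?y"
      unfolding X_def using X0c Rc y
      by (simp add: minus_mult_distrib_mat_vec[of _ n n] minus_scalar_prod_distrib[of _ n])
    also have "(R *\<^sub>v ?y) \<bullet>c ?y = (?y \<bullet>c x) * (x \<bullet>c ?y)"
      unfolding R_def by (rule outer_product_quadratic_form[OF x(1) y])
    also have "?y \<bullet>c x = v \<bullet>c (D *\<^sub>v x)"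
      using mult_mat_vec_cscalar_adjoint[OF Da v x(1)] by simp
    also have "x \<bullet>c ?y = (D *\<^sub>v x) \<bullet>c v"
      by (rule mult_mat_vec_cscalar_adjoint[OF D x(1) v, symmetric])
    finally show ?thesis
      unfolding quadratic_form_congruence[OF Xc D v] quadratic_form_congruence[OF X0c D v] .
  qed
  have "B * X * mat_adjoint B \<succeq> A"
    unfolding loewner_ge_iff[OF hermitian_mats_congruence[OF Xh B] A]
  proof
    fix v :: "complex vec" assume v: "v \<in> carrier_vec m"
    show "(A *\<^sub>v v) \<bullet>c v \<le> ((B * X * mat_adjoint B) *\<^sub>v v) \<bullet>c v"
      unfolding form[OF B v] x(2)
      using X0(2) v loewner_ge_iff[OF hermitian_mats_congruence[OF X0(1) B] A] by simp
  qed
  hence le: "C * X * mat_adjoint C \<succeq> C * X0 * mat_adjoint C" by (rule least[OF Xh])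
  \<comment> \<open>In the direction \<open>C x\<close> the perturbed matrix is smaller by the fourth power of the norm of
    \<open>C x\<close>.\<close>
  define v where "v = C *\<^sub>v x"
  have v: "v \<in> carrier_vec k" using C x(1) by (simp add: v_def)
  have "((C * X0 * mat_adjoint C) *\<^sub>v v) \<bullet>c v \<le>
      ((C * X0 * mat_adjoint C) *\<^sub>v v) \<bullet>c v - (v \<bullet>c v) * (v \<bullet>c v)"
  proof -
    have "((C * X0 * mat_adjoint C) *\<^sub>v v) \<bullet>c v \<le> ((C * X * mat_adjoint C) *\<^sub>v v) \<bullet>c v"
      using le v loewner_ge_iff[OF hermitian_mats_congruence[OF Xh C] hermitian_mats_congruence[OF X0(1) C]]
      by blast
    thus ?thesis unfolding form[OF C v] v_def[symmetric] .
  qed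
  hence le0: "(v \<bullet>c v) * (v \<bullet>c v) \<le> 0" by (simp add: less_eq_complex_def)
  have "v = 0\<^sub>v k"
  proof (rule ccontr)
    assume "v \<noteq> 0\<^sub>v k"
    hence "0 < v \<bullet>c v" using v by simp
    hence "0 < (v \<bullet>c v) * (v \<bullet>c v)" by (auto simp: less_complex_def)
    thus False using le0 by simp
  qed
  thus ?thesis by (simp add: v_def)
qed

theorem theorem4p1:
  fixes A1 A2 B1 B2 K M Xhat :: "complex mat"
    and m1 m2 n :: nat
    and \<phi> :: "complex mat \<Rightarrow> complex mat"
  assumes A1: "A1 \<in> hermitian_mats m1" and A2: "A2 \<in> hermitian_mats m2"
    and B1: "B1 \<in> carrier_mat m1 n" and B2: "B2 \<in> carrier_mat m2 n"
    and phi: "\<phi> = (\<lambda>X. A1 - B1 * X * mat_adjoint B1)"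
    and K: "K = four_block_mat (- A2) B2 (mat_adjoint B2) (0\<^sub>m n n)"
    and M: "M = (A1 @\<^sub>c 0\<^sub>m m1 m2 @\<^sub>c B1) @\<^sub>r
                (0\<^sub>m m2 m1 @\<^sub>c (- A2) @\<^sub>c B2) @\<^sub>r
                (mat_adjoint B1 @\<^sub>c mat_adjoint B2 @\<^sub>c 0\<^sub>m n n)"
    and Xhat: "Xhat = (0\<^sub>m n m2 @\<^sub>c 1\<^sub>m n) * mp_inverse K * (0\<^sub>m m2 n @\<^sub>r 1\<^sub>m n)"
    and feasible: "\<exists>X \<in> hermitian_mats n. B2 * X * mat_adjoint B2 \<succeq> A2"
  shows
    "((\<exists>X0 \<in> hermitian_mats n. B2 * X0 * mat_adjoint B2 \<succeq> A2 \<and>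
         (\<forall>X \<in> hermitian_mats n. B2 * X * mat_adjoint B2 \<succeq> A2 \<longrightarrow> \<phi> X0 \<succeq> \<phi> X))
      \<longleftrightarrow> mat_range (0\<^sub>m m2 m1 @\<^sub>r mat_adjoint B1) \<subseteq> mat_range K)
     \<and>
     (mat_range (0\<^sub>m m2 m1 @\<^sub>r mat_adjoint B1) \<subseteq> mat_range K \<longrightarrow>
       (Xhat \<in> hermitian_mats n \<and> B2 * Xhat * mat_adjoint B2 \<succeq> A2 \<and>
         (\<forall>X \<in> hermitian_mats n. B2 * X * mat_adjoint B2 \<succeq> A2 \<longrightarrow> \<phi> Xhat \<succeq> \<phi> X)) \<and>
       is_loewner_max
         {A1 - B1 * X * mat_adjoint B1 | X.
            B2 * X * mat_adjoint B2 \<succeq> A2 \<and> X \<in> hermitian_mats n}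
         (A1 - (0\<^sub>m m1 m2 @\<^sub>c B1) * mp_inverse K * (0\<^sub>m m2 m1 @\<^sub>r mat_adjoint B1)) \<and>
       int (inertia_pos
         (A1 - (0\<^sub>m m1 m2 @\<^sub>c B1) * mp_inverse K * (0\<^sub>m m2 m1 @\<^sub>r mat_adjoint B1)))
         = int (inertia_pos M) - int (inertia_pos K) \<and>
       int (inertia_neg
         (A1 - (0\<^sub>m m1 m2 @\<^sub>c B1) * mp_inverse K * (0\<^sub>m m2 m1 @\<^sub>r mat_adjoint B1)))
         = int (inertia_neg M) - int (inertia_neg K))"
proof -
  let ?feas = "\<lambda>X. B2 * X * mat_adjoint B2 \<succeq> A2"
  let ?range = "mat_range (0\<^sub>m m2 m1 @\<^sub>r mat_adjoint B1) \<subseteq> mat_range K"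
  have Kh: "K \<in> hermitian_mats (m2 + n)" unfolding K by (rule bordered_hermitian[OF A2 B2])
  note Gh = hermitian_mp_inverse(2)[OF Kh]
  note Gc = hermitian_matsD(1)[OF Gh]
  obtain X1 where X1: "X1 \<in> hermitian_mats n" "?feas X1" using feasible by blast
  have E: "0\<^sub>m n m2 @\<^sub>c 1\<^sub>m n \<in> carrier_mat n (m2 + n)"
    by (rule append_cols_zero_carrier[OF one_carrier_mat])
  have N: "0\<^sub>m m1 m2 @\<^sub>c B1 \<in> carrier_mat m1 (m2 + n)"
    by (rule append_cols_zero_carrier[OF B1])
  have Xhat_h: "Xhat \<in> hermitian_mats n"
    using hermitian_mats_congruence[OF Gh E] mat_adjoint_append_cols_zero[of "1\<^sub>m n" n n m2] by (simp add: Xhat)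
  have sandwich: "(0\<^sub>m k m2 @\<^sub>c C) * mp_inverse K * (0\<^sub>m m2 k @\<^sub>r mat_adjoint C) = C * Xhat * mat_adjoint C"
    if "C \<in> carrier_mat k n" for C k
    unfolding Xhat by (rule append_cols_sandwich[OF that Gc])
  have Xhat_feas: "?feas Xhat"
    using bordered_solution_feasible[OF A2 B2 K X1] sandwich[OF B2] by simp
  have phi_iff: "\<phi> X \<succeq> \<phi> Y \<longleftrightarrow> B1 * Y * mat_adjoint B1 \<succeq> B1 * X * mat_adjoint B1"
    if "X \<in> hermitian_mats n" "Y \<in> hermitian_mats n" for X Y
    unfolding phi using that
    by (intro minus_loewner_ge_iff[OF A1] hermitian_mats_congruence[OF _ B1])
  have max: "\<phi> Xhat \<succeq> \<phi> X" if "?range" "X \<in> hermitian_mats n" "?feas X" for X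
    using bordered_lower_bound[OF A2 B2 K B1 that] sandwich[OF B1] phi_iff[OF Xhat_h that(2)] by simp
  have necessary: "?range" if X0: "X0 \<in> hermitian_mats n" "?feas X0"
    and X0_max: "\<forall>X \<in> hermitian_mats n. ?feas X \<longrightarrow> \<phi> X0 \<succeq> \<phi> X" for X0
    unfolding bordered_range_iff[OF A2 B2 K X1 B1]
  proof (intro ballI impI)
    fix x assume x: "x \<in> carrier_vec n" "B2 *\<^sub>v x = 0\<^sub>v m2"
    show "B1 *\<^sub>v x = 0\<^sub>v m1"
      by (rule least_imp_kernel_le[OF A2 B2 B1 X0 _ x]) (use X0_max phi_iff[OF X0(1)] in blast)
  qed
  have inertia: "inertia_pos M = inertia_pos (\<phi> Xhat) + inertia_pos K \<and>
      inertia_neg M = inertia_neg (\<phi> Xhat) + inertia_neg K" if ?range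
  proof -
    have M_eq: "M = four_block_mat A1 (0\<^sub>m m1 m2 @\<^sub>c B1) (mat_adjoint (0\<^sub>m m1 m2 @\<^sub>c B1)) K"
      unfolding M K
      by (rule bordered_blocks_regroup[OF hermitian_matsD(1)[OF A1] hermitian_matsD(1)[OF A2] B1 B2])
    have "mat_range (mat_adjoint (0\<^sub>m m1 m2 @\<^sub>c B1)) \<subseteq> mat_range K"
      using that mat_adjoint_append_cols_zero[OF B1] by simp
    from inertia_schur_complement[OF A1 N Kh this] show ?thesis
      unfolding M_eq phi mat_adjoint_append_cols_zero[OF B1] sandwich[OF B1] by blast
  qed
  have value_eq: "A1 - (0\<^sub>m m1 m2 @\<^sub>c B1) * mp_inverse K * (0\<^sub>m m2 m1 @\<^sub>r mat_adjoint B1) = \<phi> Xhat"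
    by (simp only: phi sandwich[OF B1])
  have "is_loewner_max {A1 - B1 * X * mat_adjoint B1 | X. ?feas X \<and> X \<in> hermitian_mats n} (\<phi> Xhat)"
    if ?range
    unfolding is_loewner_max_def using Xhat_h Xhat_feas max[OF that] by (auto simp: phi)
  thus ?thesis
    unfolding value_eq using Xhat_h Xhat_feas max necessary inertia by auto
qed

end
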